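(* If $\sigma$ and $\rho$ are non-crossing partitions and $\sigma$ is connected, then $\sigma[\rho]$ and $\rho[\sigma]$ are cc-equivalent.
   Context: Set partitions are written in canonical sequential form (restricted growth words). A partition is non-crossing if it avoids the pattern $1212$ (pattern containment = having a subsequence order-isomorphic to the pattern). For partitions $\alpha,\beta$, $\alpha[\beta]$ is the concatenation of $\alpha$ with $\beta+r$, $r$ the number of blocks of $\alpha$. A partition $\pi$ is connected if it cannot be written as $\alpha[\beta]$ with $\alpha,\beta$ nonempty; every partition is uniquely $\pi=\sigma_1[\sigma_2]\cdots[\sigma_m]$ with nonempty connected $\sigma_i$, its components. Two non-crossing patterns $\sigma,\tau$ are cc-equivalent if there is a bijection from the set of partitions avoiding both $1212$ and $\sigma$ to the set of partitions avoiding both $1212$ and $\tau$ that preserves size and number of components. *)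

theory Defs
  imports Main
begin

text \<open>Set partitions of [n] in canonical sequential form (restricted growth words),
  letters 1,2,...: the first letter is 1 and every letter is at most one more than
  the maximum of the letters before it.\<close>
definition rgf :: "nat list \<Rightarrow> bool" where
  "rgf w \<longleftrightarrow> (\<forall>i<length w. 1 \<le> w!i \<and> w!i \<le> Suc (Max (insert 0 (set (take i w)))))"

definition nblocks :: "nat list \<Rightarrow> nat" where
  "nblocks w = Max (insert 0 (set w))"

definition contains :: "nat list \<Rightarrow> nat list \<Rightarrow> bool" where
  "contains w p \<longleftrightarrow> (\<exists>f. strict_mono_on {..<length p} f \<and> (\<forall>i<length p. f i < length w) \<and>
      (\<forall>i<length p. \<forall>j<length p. (w!(f i) \<le> w!(f j) \<longleftrightarrow> p!i \<le> p!j)))"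

definition avoids :: "nat list \<Rightarrow> nat list \<Rightarrow> bool" where
  "avoids w p \<longleftrightarrow> \<not> contains w p"

definition noncrossing :: "nat list \<Rightarrow> bool" where
  "noncrossing w \<longleftrightarrow> avoids w [1,2,1,2]"

definition pcat :: "nat list \<Rightarrow> nat list \<Rightarrow> nat list" where
  "pcat \<alpha> \<beta> = \<alpha> @ map (\<lambda>x. x + nblocks \<alpha>) \<beta>"

definition connected_part :: "nat list \<Rightarrow> bool" where
  "connected_part \<pi> \<longleftrightarrow> \<pi> \<noteq> [] \<and>
     \<not> (\<exists>\<alpha> \<beta>. rgf \<alpha> \<and> rgf \<beta> \<and> \<alpha> \<noteq> [] \<and> \<beta> \<noteq> [] \<and> \<pi> = pcat \<alpha> \<beta>)"

text \<open>Number of components: the m with \<pi> = \<sigma>1[\<sigma>2]...[\<sigma>m], \<sigma>i nonempty connected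
  (unique by the paper's remark).\<close>
definition ncomp :: "nat list \<Rightarrow> nat" where
  "ncomp \<pi> = (THE m. \<exists>ss. length ss = m \<and> (\<forall>s\<in>set ss. rgf s \<and> connected_part s) \<and>
                        \<pi> = foldl pcat [] ss)"

definition Av_nc :: "nat list \<Rightarrow> nat list set" where
  "Av_nc \<sigma> = {\<pi>. rgf \<pi> \<and> noncrossing \<pi> \<and> avoids \<pi> \<sigma>}"

definition cc_equiv :: "nat list \<Rightarrow> nat list \<Rightarrow> bool" where
  "cc_equiv \<sigma> \<tau> \<longleftrightarrow> (\<exists>f. bij_betw f (Av_nc \<sigma>) (Av_nc \<tau>) \<and>
      (\<forall>\<pi>\<in>Av_nc \<sigma>. length (f \<pi>) = length \<pi> \<and> ncomp (f \<pi>) = ncomp \<pi>))"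

end

theory Submission
  imports Defs "HOL-Library.Sublist"
begin

text \<open>A non-crossing word \<open>w\<close> contains \<open>\<sigma>[\<rho>]\<close> iff for some \<open>k\<close> the prefix of \<open>w\<close> before the first letter
  exceeding \<open>k\<close> contains \<open>\<sigma>\<close> and the subword of letters exceeding \<open>k\<close> contains \<open>\<rho>\<close>. A word containing
  \<open>\<sigma>\<close> can thus be cut either at the least \<open>k\<close> whose prefix contains \<open>\<sigma>\<close>, and then it avoids \<open>\<sigma>[\<rho>]\<close>
  iff the upper subword avoids \<open>\<rho>\<close>; or at the greatest \<open>k\<close> whose upper subword contains \<open>\<sigma>\<close>, and then
  it avoids \<open>\<rho>[\<sigma>]\<close> iff the prefix avoids \<open>\<rho>\<close>.

  Given a prefix with \<open>p\<close> components and an upper subword with \<open>q\<close> components, the words composed of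
  the two correspond to chains in a \<open>p \<times> q\<close> grid, and the distribution of size and number of
  components among them is symmetric under exchanging the two parts. It remains to see that the
  minimal prefixes (\<open>lmin\<close>) and the minimal upper subwords (\<open>rmin\<close>) containing \<open>\<sigma>\<close> are
  equinumerous: counting all non-crossing words containing \<open>\<sigma>\<close> by both cuts gives the same triangular
  recursion in the size for both.\<close>

section \<open>Pattern containment via subsequences\<close>

text \<open>Connects the index embeddings of \<open>contains_def\<close> with \<open>subseq\<close>,
  whose append and filter rules carry the later arguments.\<close>

lemma subseq_iff_index:
  "subseq s w \<longleftrightarrow>
    (\<exists>f. strict_mono_on {..<length s} f \<and> (\<forall>i<length s. f i < length w \<and> w ! f i = s ! i))"
proof
  assume "subseq s w"
  then show "\<exists>f. strict_mono_on {..<length s} f \<and> (\<forall>i<length s. f i < length w \<and> w ! f i = s ! i)"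
  proof induction
    case (list_emb_Nil ys)
    show ?case by (rule exI[of _ id]) (auto simp: strict_mono_on_def)
  next
    case (list_emb_Cons xs ys y)
    then obtain f where "strict_mono_on {..<length xs} f"
      "\<forall>i<length xs. f i < length ys \<and> ys ! f i = xs ! i" by blast
    then show ?case by (intro exI[of _ "Suc \<circ> f"]) (auto simp: strict_mono_on_def)
  next
    case (list_emb_Cons2 x y xs ys)
    then obtain f where f: "strict_mono_on {..<length xs} f"
      "\<forall>i<length xs. f i < length ys \<and> ys ! f i = xs ! i" by blast
    show ?case
    proof (intro exI[of _ "\<lambda>i. case i of 0 \<Rightarrow> 0 | Suc j \<Rightarrow> Suc (f j)"] conjI)
      show "strict_mono_on {..<length (x # xs)} (\<lambda>i. case i of 0 \<Rightarrow> 0 | Suc j \<Rightarrow> Suc (f j))"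
        using f(1) by (auto simp: strict_mono_on_def split: nat.splits)
      show "\<forall>i<length (x # xs). (case i of 0 \<Rightarrow> 0 | Suc j \<Rightarrow> Suc (f j)) < length (y # ys) \<and>
          (y # ys) ! (case i of 0 \<Rightarrow> 0 | Suc j \<Rightarrow> Suc (f j)) = (x # xs) ! i"
        using f(2) list_emb_Cons2 by (auto split: nat.splits)
    qed
  qed
next
  assume "\<exists>f. strict_mono_on {..<length s} f \<and> (\<forall>i<length s. f i < length w \<and> w ! f i = s ! i)"
  then obtain f where "strict_mono_on {..<length s} f"
    "\<forall>i<length s. f i < length w \<and> w ! f i = s ! i" by blast
  then show "subseq s w"
  proof (induction s arbitrary: w rule: rev_induct)
    case Nil
    show ?case by simp
  next
    case (snoc x s)
    \<comment> \<open>\<open>?m\<close> is the position of the last letter; strict monotonicity puts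
      all other positions before it, so the rest embeds into \<open>take ?m w\<close>.\<close>
    let ?m = "f (length s)"
    have m: "?m < length w" "w ! ?m = x" using snoc.prems(2) by (auto simp: nth_append)
    have lt: "f i < ?m" if "i < length s" for i
      using snoc.prems(1) that by (auto simp: strict_mono_on_def)
    have "subseq s (take ?m w)"
    proof (rule snoc.IH)
      show "strict_mono_on {..<length s} f"
        using snoc.prems(1) by (auto simp: strict_mono_on_def)
      show "\<forall>i<length s. f i < length (take ?m w) \<and> take ?m w ! f i = s ! i"
      proof (intro allI impI)
        fix i assume i: "i < length s"
        then have "f i < length w \<and> w ! f i = (s @ [x]) ! i" using snoc.prems(2) by simp
        then show "f i < length (take ?m w) \<and> take ?m w ! f i = s ! i"
          using i lt[OF i] by (simp add: nth_append)
      qed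
    qed
    then have "subseq (s @ [x]) (take ?m w @ (x # drop (Suc ?m) w))"
      by (intro list_emb_append_mono) auto
    also have "take ?m w @ (x # drop (Suc ?m) w) = w" using id_take_nth_drop[OF m(1)] m(2) by simp
    finally show ?case .
  qed
qed

definition oiso :: "nat list \<Rightarrow> nat list \<Rightarrow> bool" where
  "oiso s p \<longleftrightarrow> length s = length p \<and>
    (\<forall>i<length p. \<forall>j<length p. s ! i \<le> s ! j \<longleftrightarrow> p ! i \<le> p ! j)"

lemma contains_iff_subseq: "contains w p \<longleftrightarrow> (\<exists>s. subseq s w \<and> oiso s p)"
proof
  assume "contains w p"
  then obtain f where f: "strict_mono_on {..<length p} f" "\<forall>i<length p. f i < length w"
    "\<forall>i<length p. \<forall>j<length p. (w ! (f i) \<le> w ! (f j) \<longleftrightarrow> p ! i \<le> p ! j)"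
    unfolding contains_def by blast
  show "\<exists>s. subseq s w \<and> oiso s p"
  proof (intro exI[of _ "map (\<lambda>i. w ! f i) [0..<length p]"] conjI)
    show "subseq (map (\<lambda>i. w ! f i) [0..<length p]) w"
      unfolding subseq_iff_index using f(1,2) by auto
    show "oiso (map (\<lambda>i. w ! f i) [0..<length p]) p"
      using f(3) by (auto simp: oiso_def)
  qed
next
  assume "\<exists>s. subseq s w \<and> oiso s p"
  then obtain s f where "oiso s p" "strict_mono_on {..<length s} f"
    "\<forall>i<length s. f i < length w \<and> w ! f i = s ! i"
    unfolding subseq_iff_index by blast
  then show "contains w p" unfolding contains_def oiso_def by (intro exI[of _ f]) auto
qed

lemma contains_mono: "contains u p \<Longrightarrow> subseq u w \<Longrightarrow> contains w p"
  unfolding contains_iff_subseq using subseq_order.trans by blast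

lemma contains_map_add [simp]: "contains (map (\<lambda>x. x + k) w) p \<longleftrightarrow> contains w p"
  unfolding contains_def by (rule ex_cong) auto

lemma contains_Nil_left [simp]: "contains [] p \<longleftrightarrow> p = []"
  by (auto simp: contains_def strict_mono_on_def)

text \<open>Since \<open>N\<close> separates the letters of \<open>p\<close> from the shifted
  letters of \<open>q\<close>, comparisons across the two halves say only that the first half of
  \<open>s\<close> lies strictly below the second.\<close>

lemma oiso_append:
  assumes "\<And>x. x \<in> set p \<Longrightarrow> x \<le> N" and "\<And>x. x \<in> set q \<Longrightarrow> 1 \<le> x"
  shows "oiso s (p @ map (\<lambda>x. x + N) q) \<longleftrightarrow>
    (\<exists>s1 s2. s = s1 @ s2 \<and> oiso s1 p \<and> oiso s2 q \<and> (\<forall>x\<in>set s1. \<forall>y\<in>set s2. x < y))"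
    (is "oiso s ?r \<longleftrightarrow> ?R")
proof
  assume o: "oiso s ?r"
  then have len: "length s = length p + length q" by (simp add: oiso_def)
  have le: "s ! i \<le> s ! j \<longleftrightarrow> ?r ! i \<le> ?r ! j" if "i < length p + length q" "j < length p + length q" for i j
    using o that by (simp add: oiso_def)
  show ?R
  proof (intro exI conjI)
    show "s = take (length p) s @ drop (length p) s" by simp
    show "oiso (take (length p) s) p"
      unfolding oiso_def using len
    proof (intro conjI allI impI)
      fix i j assume "i < length p" "j < length p"
      then show "(take (length p) s ! i \<le> take (length p) s ! j) = (p ! i \<le> p ! j)"
        using le[of i j] by (simp add: nth_append)
    qed simp
    show "oiso (drop (length p) s) q"
      unfolding oiso_def
    proof (intro conjI allI impI)
      fix i j assume "i < length q" "j < length q"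
      then show "(drop (length p) s ! i \<le> drop (length p) s ! j) = (q ! i \<le> q ! j)"
        using le[of "length p + i" "length p + j"] len by (simp add: nth_append)
    qed (simp add: len)
    show "\<forall>x\<in>set (take (length p) s). \<forall>y\<in>set (drop (length p) s). x < y"
    proof (intro ballI)
      fix x y assume "x \<in> set (take (length p) s)" "y \<in> set (drop (length p) s)"
      then obtain i j where ij: "i < length p" "x = s ! i" "j < length q" "y = s ! (length p + j)"
        using len by (auto simp: in_set_conv_nth)
      then have "\<not> ?r ! (length p + j) \<le> ?r ! i"
        using assms(1)[of "p ! i"] assms(2)[of "q ! j"] by (auto simp: nth_append)
      then show "x < y" using ij le[of "length p + j" i] by simp
    qed
  qed
next
  assume ?R
  then obtain s1 s2 where s: "s = s1 @ s2" "oiso s1 p" "oiso s2 q"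
    and lt: "\<And>x y. x \<in> set s1 \<Longrightarrow> y \<in> set s2 \<Longrightarrow> x < y" by blast
  have len: "length s1 = length p" "length s2 = length q" using s by (auto simp: oiso_def)
  show "oiso s ?r"
    unfolding oiso_def
  proof (intro conjI allI impI)
    show "length s = length ?r" using s(1) len by simp
    fix i j assume ij: "i < length ?r" "j < length ?r"
    have P: "p ! a \<le> N" "s1 ! a \<in> set s1" if "a < length p" for a
      using that assms(1) len by auto
    have Q: "1 \<le> q ! (a - length p)" "s2 ! (a - length p) \<in> set s2"
      if "\<not> a < length p" "a < length p + length q" for a
      using that assms(2) len by auto
    show "(s ! i \<le> s ! j) = (?r ! i \<le> ?r ! j)"
    proof (cases "i < length p"; cases "j < length p")
      assume "i < length p" "j < length p"
      then show ?thesis using s len by (simp add: nth_append oiso_def)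
    next
      assume a: "i < length p" "\<not> j < length p"
      then have "s1 ! i < s2 ! (j - length p)" using P[of i] Q[of j] lt ij by auto
      then show ?thesis using a P[of i] Q[of j] ij s(1) len by (simp add: nth_append)
    next
      assume a: "\<not> i < length p" "j < length p"
      then have "s1 ! j < s2 ! (i - length p)" using P[of j] Q[of i] lt ij by auto
      then show ?thesis using a P[of j] Q[of i] ij s(1) len by (simp add: nth_append)
    next
      assume a: "\<not> i < length p" "\<not> j < length p"
      then have "i - length p < length q" "j - length p < length q" using ij by auto
      then show ?thesis using a s len by (simp add: nth_append oiso_def)
    qed
  qed
qed

lemma contains_1212: "contains w [1,2,1,2] \<longleftrightarrow> (\<exists>a b. a < b \<and> subseq [a,b,a,b] w)"
proof
  assume "contains w [1,2,1,2]"
  then obtain s where s: "subseq s w" "oiso s [1,2,1,2]" unfolding contains_iff_subseq by blast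
  then have len: "length s = 4" and
    le: "\<And>i j. i < 4 \<Longrightarrow> j < 4 \<Longrightarrow> s ! i \<le> s ! j \<longleftrightarrow> [1,2,1,2::nat] ! i \<le> [1,2,1,2] ! j"
    by (simp_all add: oiso_def)
  from len obtain a b c d where sd: "s = [a,b,c,d]"
    by (auto simp: length_Suc_conv numeral_eq_Suc)
  have "a = c" "b = d" "a < b"
    using le[of 0 2] le[of 2 0] le[of 1 3] le[of 3 1] le[of 1 0]
    by (simp_all add: sd numeral_eq_Suc)
  then show "\<exists>a b. a < b \<and> subseq [a,b,a,b] w" using s(1) sd by blast
next
  assume "\<exists>a b. a < b \<and> subseq [a,b,a,b] w"
  then obtain a b where ab: "a < b" "subseq [a,b,a,b] w" by blast
  have "oiso [a,b,a,b] [1,2,1,2]"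
    unfolding oiso_def using ab(1) by (auto simp: less_Suc_eq numeral_eq_Suc)
  then show "contains w [1,2,1,2]" using ab(2) unfolding contains_iff_subseq by blast
qed

lemma noncrossing_iff: "noncrossing w \<longleftrightarrow> \<not> (\<exists>a b. a < b \<and> subseq [a,b,a,b] w)"
  unfolding noncrossing_def avoids_def contains_1212 ..

section \<open>Restricted growth words and their components\<close>

text \<open>The base value \<open>M\<close> lets the letters above \<open>M\<close> in a longer word
  be treated as a word of their own without shifting them down; \<open>mx 0\<close> is
  \<open>nblocks\<close>.\<close>

definition mx :: "nat \<Rightarrow> nat list \<Rightarrow> nat" where
  "mx M w = Max (insert M (set w))"

lemma mx_Nil [simp]: "mx M [] = M"
  by (simp add: mx_def)

lemma mx_snoc [simp]: "mx M (w @ [x]) = max x (mx M w)"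
  by (simp add: mx_def insert_commute[of M])

lemma mx_append: "mx M (u @ v) = mx (mx M u) v"
proof (induction v rule: rev_induct)
  case (snoc x v)
  then show ?case by (simp flip: append_assoc)
qed simp

lemma mx_ge: "x \<in> set w \<Longrightarrow> x \<le> mx M w" "M \<le> mx M w"
  by (auto simp: mx_def)

lemma nblocks_mx: "nblocks = mx 0"
  by (simp add: nblocks_def mx_def fun_eq_iff)

lemma rgf_Nil [simp]: "rgf []"
  by (simp add: rgf_def)

lemma rgf_snoc: "rgf (w @ [x]) \<longleftrightarrow> rgf w \<and> 1 \<le> x \<and> x \<le> Suc (mx 0 w)"
  unfolding rgf_def mx_def by (auto simp: nth_append less_Suc_eq all_conj_distrib)

lemma rgf_ge1: "rgf w \<Longrightarrow> x \<in> set w \<Longrightarrow> 1 \<le> x"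
  by (auto simp: rgf_def in_set_conv_nth)

lemma mx_map_add [simp]: "mx k (map (\<lambda>x. x + k) w) = mx 0 w + k"
  by (induction w rule: rev_induct) auto

lemma nblocks_pcat: "nblocks (pcat \<alpha> \<beta>) = nblocks \<alpha> + nblocks \<beta>"
  by (simp add: pcat_def nblocks_mx mx_append)

lemma pcat_assoc: "pcat (pcat \<alpha> \<beta>) \<gamma> = pcat \<alpha> (pcat \<beta> \<gamma>)"
  by (simp add: pcat_def[of "pcat \<alpha> \<beta>"] nblocks_pcat) (simp add: pcat_def add_ac)

lemma pcat_Nil [simp]: "pcat [] \<beta> = \<beta>" "pcat \<alpha> [] = \<alpha>"
  by (simp_all add: pcat_def nblocks_mx)

lemma foldl_pcat: "foldl pcat \<alpha> ss = pcat \<alpha> (foldl pcat [] ss)"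
  by (induction ss rule: rev_induct) (auto simp: pcat_assoc)

lemma rgf_pcat: "rgf \<alpha> \<Longrightarrow> rgf \<beta> \<Longrightarrow> rgf (pcat \<alpha> \<beta>)"
proof (induction \<beta> rule: rev_induct)
  case (snoc x \<beta>)
  have "pcat \<alpha> (\<beta> @ [x]) = pcat \<alpha> \<beta> @ [x + nblocks \<alpha>]" by (simp add: pcat_def)
  then show ?case
    using snoc nblocks_pcat[of \<alpha> \<beta>] by (auto simp: rgf_snoc nblocks_mx)
qed simp

lemma mx_map_diff: "\<forall>y\<in>set v. k < y \<Longrightarrow> mx k v = mx 0 (map (\<lambda>x. x - k) v) + k"
  by (induction v rule: rev_induct) auto

lemma rgf_drop_shift:
  "rgf (u @ v) \<Longrightarrow> \<forall>y\<in>set v. mx 0 u < y \<Longrightarrow> rgf (map (\<lambda>x. x - mx 0 u) v)"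
proof (induction v rule: rev_induct)
  case (snoc x v)
  have "rgf ((u @ v) @ [x])" using snoc.prems(1) by simp
  then have *: "rgf (u @ v)" "x \<le> Suc (mx (mx 0 u) v)" unfolding rgf_snoc by (auto simp: mx_append)
  have "mx (mx 0 u) v = mx 0 (map (\<lambda>x. x - mx 0 u) v) + mx 0 u"
    using snoc.prems(2) by (intro mx_map_diff) auto
  then show ?case using * snoc by (auto simp: rgf_snoc)
qed simp

section \<open>Component boundaries and the number of components\<close>

definition is_cut :: "nat list \<Rightarrow> nat \<Rightarrow> bool" where
  "is_cut w k \<longleftrightarrow> (\<forall>x\<in>set (take k w). \<forall>y\<in>set (drop k w). x < y)"

text \<open>Position \<open>0\<close> counts and \<open>length w\<close> does not, so for a nonempty
  restricted growth word these are the positions where components begin.\<close>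

definition starts :: "nat list \<Rightarrow> nat set" where
  "starts w = {k. k < length w \<and> is_cut w k}"

text \<open>The same boundaries read as component ends. Excluding \<open>0\<close> matters once cuts
  become insertion points: no old letter may precede the first new one.\<close>

definition cuts :: "nat list \<Rightarrow> nat set" where
  "cuts w = {k. 0 < k \<and> k \<le> length w \<and> is_cut w k}"

lemma finite_starts [simp]: "finite (starts w)" and finite_cuts [simp]: "finite (cuts w)"
  by (auto simp: starts_def cuts_def)

text \<open>Beginnings from \<open>k\<close> on and ends after \<open>k\<close> share every boundary
  strictly between \<open>k\<close> and \<open>length w\<close>; for \<open>k < length w\<close> the
  former add \<open>k\<close> and the latter add \<open>length w\<close>.\<close>

lemma card_starts_cuts:
  assumes "k \<in> cuts w"
  shows "card {s\<in>starts w. k \<le> s} = card {c\<in>cuts w. k < c}"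
proof (cases "k = length w")
  case True
  then show ?thesis by (auto simp: starts_def cuts_def intro!: arg_cong[of _ _ card])
next
  case False
  let ?B = "{c. k < c \<and> c < length w \<and> is_cut w c}"
  have "{s\<in>starts w. k \<le> s} = insert k ?B" "{c\<in>cuts w. k < c} = insert (length w) ?B"
    using assms False by (auto simp: starts_def cuts_def is_cut_def)
  moreover have "finite ?B" by (rule finite_subset[of _ "{..<length w}"]) auto
  ultimately show ?thesis by simp
qed

lemma card_starts_eq_card_cuts: "card (starts w) = card (cuts w)"
proof (cases "w = []")
  case False
  let ?B = "{c. 0 < c \<and> c < length w \<and> is_cut w c}"
  have "starts w = insert 0 ?B" "cuts w = insert (length w) ?B"
    using False by (auto simp: starts_def cuts_def is_cut_def)
  moreover have "finite ?B" by (rule finite_subset[of _ "{..<length w}"]) auto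
  ultimately show ?thesis by simp
qed (auto simp: starts_def cuts_def)

lemma starts_pcat:
  assumes "rgf \<beta>"
  shows "starts (pcat \<alpha> \<beta>) = starts \<alpha> \<union> (\<lambda>s. s + length \<alpha>) ` starts \<beta>"
proof -
  let ?N = "mx 0 \<alpha>"
  have lt: "x < y + ?N" if "x \<in> set \<alpha>" "y \<in> set \<beta>" for x y
    using mx_ge(1)[OF that(1), of 0] rgf_ge1[OF assms that(2)] by linarith
  have pc: "pcat \<alpha> \<beta> = \<alpha> @ map (\<lambda>x. x + ?N) \<beta>" by (simp add: pcat_def nblocks_mx)
  have 1: "is_cut (pcat \<alpha> \<beta>) s \<longleftrightarrow> is_cut \<alpha> s" if "s < length \<alpha>" for s
    using that lt by (auto simp: pc is_cut_def dest: in_set_takeD)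
  have 2: "is_cut (pcat \<alpha> \<beta>) (t + length \<alpha>) \<longleftrightarrow> is_cut \<beta> t" for t
    using lt by (auto simp: pc is_cut_def take_map drop_map ball_Un dest: in_set_dropD)
  show ?thesis
  proof (intro set_eqI iffI)
    fix s assume s: "s \<in> starts (pcat \<alpha> \<beta>)"
    show "s \<in> starts \<alpha> \<union> (\<lambda>s. s + length \<alpha>) ` starts \<beta>"
    proof (cases "s < length \<alpha>")
      case True
      then show ?thesis using s 1 by (simp add: starts_def)
    next
      case False
      then have "s = (s - length \<alpha>) + length \<alpha>" by simp
      moreover have "s - length \<alpha> \<in> starts \<beta>"
        using s 2[of "s - length \<alpha>"] False by (auto simp: starts_def pc)
      ultimately show ?thesis by blast
    qed
  qed (auto simp: starts_def 1 2, auto simp: pc)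
qed

text \<open>A second start would split the word as a \<open>pcat\<close> of its prefix and the
  shifted remainder.\<close>

lemma starts_connected:
  assumes "rgf w" "connected_part w"
  shows "starts w = {0}"
proof -
  have "s = 0" if "s \<in> starts w" for s
  proof (rule ccontr)
    assume "s \<noteq> 0"
    let ?u = "take s w" and ?v = "drop s w"
    have s: "s < length w" "is_cut w s" using that by (auto simp: starts_def)
    have "?u \<noteq> []" using s \<open>s \<noteq> 0\<close> by auto
    \<comment> \<open>The maximum is attained in \<open>?u\<close> or is the default
      \<open>0\<close>; since letters are positive, \<open>?v\<close> lies above it in either
      case.\<close>
    then have "mx 0 ?u \<in> set ?u \<or> mx 0 ?u = 0" using Max_in[of "insert 0 (set ?u)"] by (auto simp: mx_def)
    then have gt: "\<forall>y\<in>set ?v. mx 0 ?u < y"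
      using s(2) rgf_ge1[OF assms(1)] by (fastforce simp: is_cut_def dest: in_set_dropD)
    have "rgf (map (\<lambda>x. x - mx 0 ?u) ?v)" using gt assms(1) by (intro rgf_drop_shift) auto
    moreover have "rgf ?u" using assms(1) by (auto simp: rgf_def min_def)
    moreover have "w = pcat ?u (map (\<lambda>x. x - mx 0 ?u) ?v)"
    proof -
      have "map ((\<lambda>x. x + mx 0 ?u) \<circ> (\<lambda>x. x - mx 0 ?u)) ?v = ?v" using gt by (intro map_idI) auto
      then show ?thesis by (simp add: pcat_def nblocks_mx del: map_map add: map_map[symmetric])
    qed
    ultimately show False
      using assms(2) \<open>?u \<noteq> []\<close> s(1) unfolding connected_part_def by (metis drop_eq_Nil leD map_is_Nil_conv)
  qed
  moreover have "0 \<in> starts w" using assms(2) by (simp add: starts_def is_cut_def connected_part_def)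
  ultimately show ?thesis by blast
qed

text \<open>Appending a connected part adds exactly one start, at the junction. Hence all
  decompositions into connected parts have the same number of parts, which settles the definite
  description in \<open>ncomp\<close>.\<close>

lemma card_starts_foldl:
  "\<forall>s\<in>set ss. rgf s \<and> connected_part s \<Longrightarrow>
    rgf (foldl pcat [] ss) \<and> card (starts (foldl pcat [] ss)) = length ss"
proof (induction ss rule: rev_induct)
  case Nil
  show ?case by (simp add: starts_def)
next
  case (snoc s ss)
  let ?f = "foldl pcat [] ss"
  have s: "rgf s" "connected_part s" using snoc.prems by auto
  have IH: "rgf ?f" "card (starts ?f) = length ss" using snoc by auto
  have "starts (pcat ?f s) = insert (length ?f) (starts ?f)"
    using starts_pcat[OF s(1), of ?f] starts_connected[OF s] by auto
  moreover have "length ?f \<notin> starts ?f" by (simp add: starts_def)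
  ultimately show ?case using IH rgf_pcat[OF IH(1) s(1)] by simp
qed

lemma components_exist:
  "rgf w \<Longrightarrow> \<exists>ss. (\<forall>s\<in>set ss. rgf s \<and> connected_part s) \<and> w = foldl pcat [] ss"
proof (induction w rule: length_induct)
  case (1 w)
  consider "w = []" | "connected_part w"
    | \<alpha> \<beta> where "rgf \<alpha>" "rgf \<beta>" "\<alpha> \<noteq> []" "\<beta> \<noteq> []" "w = pcat \<alpha> \<beta>"
    unfolding connected_part_def by blast
  then show ?case
  proof cases
    case 1
    then show ?thesis by (intro exI[of _ "[]"]) simp
  next
    case 2
    then show ?thesis using 1 by (intro exI[of _ "[w]"]) simp
  next
    case 3
    then have "length \<alpha> < length w" "length \<beta> < length w" by (auto simp: pcat_def)
    then have
      "\<exists>ss. (\<forall>s\<in>set ss. rgf s \<and> connected_part s) \<and> \<alpha> = foldl pcat [] ss"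
      "\<exists>ss. (\<forall>s\<in>set ss. rgf s \<and> connected_part s) \<and> \<beta> = foldl pcat [] ss"
      using "1.IH" 3 by blast+
    then obtain ss ts where
      "\<forall>s\<in>set ss. rgf s \<and> connected_part s" "\<alpha> = foldl pcat [] ss"
      "\<forall>s\<in>set ts. rgf s \<and> connected_part s" "\<beta> = foldl pcat [] ts"
      by blast
    moreover have "foldl pcat [] (ss @ ts) = pcat (foldl pcat [] ss) (foldl pcat [] ts)"
      by (simp only: foldl_append foldl_pcat[of "foldl pcat [] ss"])
    ultimately show ?thesis
      using 3(5) by (intro exI[of _ "ss @ ts"]) (simp only: set_append ball_Un simp_thms)
  qed
qed

lemma ncomp_eq_card_starts:
  assumes "rgf w"
  shows "ncomp w = card (starts w)"
  unfolding ncomp_def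
proof (rule the_equality)
  obtain ss where ss: "\<forall>s\<in>set ss. rgf s \<and> connected_part s" "w = foldl pcat [] ss"
    using components_exist[OF assms] by blast
  then have "length ss = card (starts w)" using card_starts_foldl by simp
  with ss show "\<exists>ss. length ss = card (starts w) \<and> (\<forall>s\<in>set ss. rgf s \<and> connected_part s) \<and>
      w = foldl pcat [] ss"
    by blast
next
  fix m
  assume "\<exists>ss. length ss = m \<and> (\<forall>s\<in>set ss. rgf s \<and> connected_part s) \<and> w = foldl pcat [] ss"
  then obtain ss where "length ss = m" "\<forall>s\<in>set ss. rgf s \<and> connected_part s" "w = foldl pcat [] ss"
    by blast
  then show "m = card (starts w)" using card_starts_foldl by simp
qed

lemma set_subseq: "subseq s w \<Longrightarrow> set s \<subseteq> set w"
  by (auto elim: list_emb_set)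

lemma nth_in_set_take: "i < k \<Longrightarrow> i < length w \<Longrightarrow> w ! i \<in> set (take k w)"
  by (auto simp: in_set_conv_nth)

lemma nth_in_set_drop: "k < length w \<Longrightarrow> w ! k \<in> set (drop k w)"
  by (simp add: Cons_nth_drop_Suc[symmetric])

section \<open>Non-crossing words as stack sequences\<close>

text \<open>The letters of a non-crossing word that may still be repeated are its right-to-left minima.
  Reading a word letter by letter, they form a stack: a new letter is pushed, and repeating an old
  letter pops everything above it.\<close>

definition opens :: "nat list \<Rightarrow> nat set" where
  "opens w = foldl (\<lambda>S x. insert x {y\<in>S. y < x}) {} w"

lemma opens_Nil [simp]: "opens [] = {}"
  by (simp add: opens_def)

lemma opens_snoc: "opens (w @ [x]) = insert x {y\<in>opens w. y < x}"
  by (simp add: opens_def)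

lemma opens_subset: "opens w \<subseteq> set w"
  by (induction w rule: rev_induct) (auto simp: opens_snoc)

lemma finite_opens [simp]: "finite (opens w)"
  using opens_subset by (rule finite_subset) simp

lemma opens_le_last: "w \<noteq> [] \<Longrightarrow> x \<in> opens w \<Longrightarrow> x \<le> last w"
  by (cases w rule: rev_cases) (auto simp: opens_snoc)

text \<open>Only a later smaller letter pops \<open>x\<close>, so membership in the stack is
  witnessed by a single occurrence. This is the form in which crossings are detected.\<close>

lemma opens_iff: "x \<in> opens w \<longleftrightarrow> (\<exists>u v. w = u @ x # v \<and> (\<forall>y\<in>set v. x \<le> y))"
proof (induction w rule: rev_induct)
  case (snoc z w)
  show ?case
  proof
    assume "x \<in> opens (w @ [z])"
    then consider "x = z" | "x \<in> opens w" "x < z" by (auto simp: opens_snoc)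
    then show "\<exists>u v. w @ [z] = u @ x # v \<and> (\<forall>y\<in>set v. x \<le> y)"
    proof cases
      case 1
      then show ?thesis by (intro exI[of _ w] exI[of _ "[]"]) simp
    next
      case 2
      then obtain u v where "w = u @ x # v" "\<forall>y\<in>set v. x \<le> y" using snoc by blast
      then show ?thesis using 2 by (intro exI[of _ u] exI[of _ "v @ [z]"]) auto
    qed
  next
    assume "\<exists>u v. w @ [z] = u @ x # v \<and> (\<forall>y\<in>set v. x \<le> y)"
    then obtain u v where uv: "w @ [z] = u @ x # v" "\<forall>y\<in>set v. x \<le> y" by blast
    show "x \<in> opens (w @ [z])"
    proof (cases v rule: rev_cases)
      case (snoc v' z')
      then have "w = u @ x # v'" "z' = z" using uv(1) by auto
      then have "x \<in> opens w" "x \<le> z" using uv(2) snoc snoc.IH by auto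
      then show ?thesis by (auto simp: opens_snoc)
    qed (use uv in \<open>auto simp: opens_snoc\<close>)
  qed
qed simp

text \<open>Generates words letter by letter above the base \<open>M\<close>: the next letter is new
  or repeats a letter on the stack. \<open>M = 0\<close> gives the non-crossing restricted growth
  words, other values describe upper subwords.\<close>

inductive nc :: "nat \<Rightarrow> nat list \<Rightarrow> bool" for M where
  nc_Nil [simp]: "nc M []"
| nc_step: "nc M w \<Longrightarrow> x = Suc (mx M w) \<or> x \<in> opens w \<Longrightarrow> nc M (w @ [x])"

lemma nc_snoc: "nc M (w @ [x]) \<longleftrightarrow> nc M w \<and> (x = Suc (mx M w) \<or> x \<in> opens w)"
proof
  assume "nc M (w @ [x])"
  then show "nc M w \<and> (x = Suc (mx M w) \<or> x \<in> opens w)" by cases auto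
qed (auto intro: nc_step)

lemma nc_appendD: "nc M (u @ v) \<Longrightarrow> nc M u"
proof (induction v rule: rev_induct)
  case (snoc x v)
  then have "nc M ((u @ v) @ [x])" by simp
  then show ?case using snoc.IH unfolding nc_snoc by blast
qed simp

lemma set_nc:
  assumes "nc M w"
  shows "set w = {M<..mx M w}"
  using assms
proof induction
  case (nc_step w x)
  show ?case
  proof (cases "x \<in> opens w")
    case True
    then have "x \<in> set w" using opens_subset by blast
    then have "insert x (set w) = set w" "max x (mx M w) = mx M w"
      using mx_ge(1)[of x w M] by auto
    then show ?thesis using nc_step.IH by simp
  next
    case False
    then have "x = Suc (mx M w)" using nc_step.hyps by blast
    then have "{M<..max x (mx M w)} = insert x {M<..mx M w}"
      using mx_ge(2)[of M w] by (simp add: set_eq_iff) linarith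
    then show ?thesis using nc_step.IH by simp
  qed
qed simp

lemma nc_mx_le: "nc M w \<Longrightarrow> mx M w \<le> M + length w"
proof (induction w rule: rev_induct)
  case (snoc x w)
  then have "x = Suc (mx M w) \<or> x \<in> set w" using opens_subset by (auto simp: nc_snoc)
  then show ?case using snoc mx_ge(1)[of x w M] by (auto simp: nc_snoc)
qed simp

lemma nc_imp_rgf: "nc 0 w \<Longrightarrow> rgf w"
proof (induction w rule: rev_induct)
  case (snoc x w)
  then have "x = Suc (mx 0 w) \<or> x \<in> set w" using opens_subset by (auto simp: nc_snoc)
  then show ?case
    using snoc mx_ge(1)[of x w 0] rgf_ge1[of w x] by (auto simp: rgf_snoc nc_snoc)
qed simp

lemma rgf_set: "rgf w \<Longrightarrow> set w = {0<..mx 0 w}"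
proof (induction w rule: rev_induct)
  case (snoc x w)
  then have x: "1 \<le> x" "x \<le> Suc (mx 0 w)" and IH: "set w = {0<..mx 0 w}"
    unfolding rgf_snoc by blast+
  have "{0<..max x (mx 0 w)} = insert x {0<..mx 0 w}" using x by (simp add: set_eq_iff) linarith
  then show ?case using IH by simp
qed simp

lemma rgf_appendD: "rgf (u @ v) \<Longrightarrow> rgf u"
proof (induction v rule: rev_induct)
  case (snoc x v)
  then have "rgf ((u @ v) @ [x])" by simp
  then show ?case using snoc.IH unfolding rgf_snoc by blast
qed simp

text \<open>Appending a repeated letter \<open>x\<close> to a non-crossing word creates a crossing
  exactly when \<open>x\<close> is not open: a smaller \<open>y\<close> after an occurrence of
  \<open>x\<close> also stands before it by restricted growth, which gives
  \<open>y x y x\<close>.\<close>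

lemma nc_iff: "nc 0 w \<longleftrightarrow> rgf w \<and> noncrossing w"
proof (induction w rule: rev_induct)
  case Nil
  show ?case by (simp add: noncrossing_def avoids_def)
next
  case (snoc x w)
  have nx: "noncrossing w" if "noncrossing (w @ [x])"
    using that contains_mono[of w "[1,2,1,2]" "w @ [x]"] by (auto simp: noncrossing_def avoids_def)
  have "x = Suc (mx 0 w) \<or> x \<in> opens w \<longleftrightarrow> 1 \<le> x \<and> x \<le> Suc (mx 0 w) \<and> noncrossing (w @ [x])"
    if w: "rgf w" "noncrossing w"
  proof
    assume x: "x = Suc (mx 0 w) \<or> x \<in> opens w"
    have nw: "\<not> subseq [a, b, a, b] w" if "a < b" for a b
      using w(2) that unfolding noncrossing_iff by blast
    have "noncrossing (w @ [x])"
      unfolding noncrossing_iff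
    proof clarify
      fix a b assume ab: "a < b" "subseq [a, b, a, b] (w @ [x])"
      then have "b = x" "subseq [a, x, a] w"
        using nw[OF ab(1)] subseq_append[of "[a,b,a]" "[b]" w]
        by (auto simp: subseq_append_iff[of _ w "[x]"] Cons_eq_append_conv split: if_splits)
      then have "x \<in> set w" using set_subseq by fastforce
      then have "x \<in> opens w" using x mx_ge(1)[of x w 0] by auto
      then obtain u v where uv: "w = u @ x # v" "\<forall>y\<in>set v. x \<le> y" unfolding opens_iff by blast
      \<comment> \<open>Letters below \<open>x\<close> occur only in \<open>u\<close>, so
        \<open>a x a\<close> lies in \<open>u\<close> and already forms a crossing with the
        \<open>x\<close> that follows \<open>u\<close>.\<close>
      have "a \<notin> set (x # v)" using uv ab(1) \<open>b = x\<close> by auto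
      moreover obtain s t where st: "[a, x, a] = s @ t" "subseq s u" "subseq t (x # v)"
        using \<open>subseq [a, x, a] w\<close> unfolding uv(1) by (rule subseq_appendE)
      ultimately have "a \<notin> set t" using set_subseq by blast
      then have "t = []" using arg_cong[OF st(1), of last] by (cases t rule: rev_cases) auto
      then have "subseq [a, x, a] u" using st by simp
      then have "subseq ([a, x, a] @ [x]) (u @ x # v)" by (intro list_emb_append_mono) auto
      then show False using nw[of a x] ab(1) \<open>b = x\<close> uv(1) by simp
    qed
    moreover have "1 \<le> x \<and> x \<le> Suc (mx 0 w)"
      using x opens_subset[of w] rgf_ge1[OF w(1), of x] mx_ge(1)[of x w 0] by fastforce
    ultimately show "1 \<le> x \<and> x \<le> Suc (mx 0 w) \<and> noncrossing (w @ [x])" by blast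
  next
    assume x: "1 \<le> x \<and> x \<le> Suc (mx 0 w) \<and> noncrossing (w @ [x])"
    show "x = Suc (mx 0 w) \<or> x \<in> opens w"
    proof (rule ccontr)
      assume neg: "\<not> (x = Suc (mx 0 w) \<or> x \<in> opens w)"
      then have "x \<in> set w" using x rgf_set[OF w(1)] by auto
      then obtain u v where uv: "w = u @ x # v" by (meson split_list)
      then obtain y where y: "y \<in> set v" "y < x" using neg unfolding opens_iff by force
      have ux: "rgf (u @ [x])" using rgf_appendD[of "u @ [x]" v] w(1) uv by simp
      have "1 \<le> y" using rgf_ge1[OF w(1)] y uv by auto
      moreover have "x \<le> mx 0 (u @ [x])" by simp
      ultimately have "y \<in> set (u @ [x])" unfolding rgf_set[OF ux] using y by auto
      then have "y \<in> set u" using y by auto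
      then have "subseq ([y] @ [x] @ [y] @ [x]) (u @ [x] @ v @ [x])"
        using y by (intro list_emb_append_mono) (auto simp: subseq_singleton_left)
      then show False
        using x y uv by (auto simp: noncrossing_iff)
    qed
  qed
  then show ?case using snoc nx by (auto simp: nc_snoc rgf_snoc)
qed

lemma opens_map_add: "opens (map (\<lambda>x. x + k) w) = (\<lambda>x. x + k) ` opens w"
  by (induction w rule: rev_induct) (auto simp: opens_snoc)

lemma nc_map_add [simp]: "nc k (map (\<lambda>x. x + k) w) \<longleftrightarrow> nc 0 w"
  by (induction w rule: rev_induct) (auto simp: nc_snoc opens_map_add)

lemma cuts_map_add [simp]: "cuts (map (\<lambda>x. x + k) w) = cuts w"
  by (simp add: cuts_def is_cut_def take_map drop_map)

text \<open>New letters added after \<open>u\<close> exceed \<open>mx M u\<close>, so an old letter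
  never re-enters the stack once it has been popped.\<close>

lemma opens_old:
  assumes "nc M (u @ v)" "x \<in> opens (u @ v)" "x \<le> mx M u"
  shows "x \<in> opens u \<and> (\<forall>y\<in>set v. x \<le> y)"
  using assms
proof (induction v rule: rev_induct)
  case (snoc z v)
  have nc: "nc M (u @ v)" "z = Suc (mx M (u @ v)) \<or> z \<in> opens (u @ v)"
    using snoc.prems(1) nc_snoc[of M "u @ v" z] by auto
  have "x \<in> opens ((u @ v) @ [z])" using snoc.prems(2) by simp
  then have z: "x = z \<or> x \<in> opens (u @ v) \<and> x < z" unfolding opens_snoc by auto
  moreover have "mx M u \<le> mx M (u @ v)" by (simp add: mx_append mx_ge)
  ultimately have "x \<in> opens (u @ v)" using nc(2) snoc.prems(3) by auto
  then show ?case using snoc.IH nc(1) snoc.prems(3) z by auto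
qed simp

text \<open>An old letter can recur only if it is open in \<open>u\<close>, and open letters do not
  exceed \<open>last u\<close>.\<close>

lemma nc_letter_above:
  assumes "nc M (u @ v)" "u \<noteq> []" "y \<in> set v" "last u < y"
  shows "mx M u < y"
proof (rule ccontr)
  assume le: "\<not> mx M u < y"
  obtain v1 v2 where v: "v = v1 @ y # v2" using assms(3) by (meson split_list)
  have nc: "nc M ((u @ v1) @ [y])" using nc_appendD[of M "(u @ v1) @ [y]" v2] assms(1) v by simp
  moreover have "mx M u \<le> mx M (u @ v1)" by (simp add: mx_append mx_ge)
  ultimately have "y \<in> opens (u @ v1)" using le unfolding nc_snoc by auto
  moreover have "nc M (u @ v1)" using nc unfolding nc_snoc by blast
  ultimately have "y \<in> opens u" using opens_old le by auto
  then show False using opens_le_last assms(2,4) by fastforce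
qed

text \<open>The component starting at position \<open>s\<close> is represented on the stack by its first letter.\<close>

lemma bij_betw_starts_opens:
  assumes "nc M w"
  shows "bij_betw (\<lambda>s. w ! s) (starts w) (opens w)"
proof -
  have mono: "w ! s < w ! t" if "t \<in> starts w" "s < t" for s t w
  proof -
    have t: "t < length w" "is_cut w t" using that by (auto simp: starts_def)
    then have "w ! s \<in> set (take t w)" "w ! t \<in> set (drop t w)"
      using that(2) by (auto intro: nth_in_set_take nth_in_set_drop)
    then show ?thesis using t(2) by (auto simp: is_cut_def)
  qed
  have "inj_on (\<lambda>s. w ! s) (starts w)"
  proof (rule inj_onI)
    fix s t assume "s \<in> starts w" "t \<in> starts w" "w ! s = w ! t"
    then show "s = t" using mono[of s w t] mono[of t w s] by (cases s t rule: linorder_cases) auto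
  qed
  moreover have "(\<lambda>s. w ! s) ` starts w = opens w"
    using assms
  proof (induction w rule: rev_induct)
    case Nil
    show ?case by (simp add: starts_def)
  next
    case (snoc x w)
    have IH: "(\<lambda>s. w ! s) ` starts w = opens w" and x: "x = Suc (mx M w) \<or> x \<in> opens w"
      using snoc by (auto simp: nc_snoc)
    have st: "starts (w @ [x]) = {s\<in>starts w. \<forall>y\<in>set (take s w). y < x} \<union>
        (if \<forall>y\<in>set w. y < x then {length w} else {})"
      by (auto simp: starts_def is_cut_def less_Suc_eq)
    from x show ?case
    proof
      assume new: "x = Suc (mx M w)"
      then have lt: "y < x" if "y \<in> set w" for y using mx_ge(1)[OF that, of M] by simp
      then have "starts (w @ [x]) = insert (length w) (starts w)"
        unfolding st by (auto dest: in_set_takeD)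
      moreover have "(\<lambda>s. (w @ [x]) ! s) ` starts w = (\<lambda>s. w ! s) ` starts w"
        by (rule image_cong) (auto simp: starts_def nth_append)
      ultimately show ?thesis
        using IH lt opens_subset[of w] by (auto simp: opens_snoc)
    next
      assume "x \<in> opens w"
      then obtain s where s: "s \<in> starts w" "x = w ! s" using IH by auto
      have sl: "s < length w" "is_cut w s" using s by (auto simp: starts_def)
      \<comment> \<open>Repeating \<open>x = w ! s\<close> destroys precisely the starts after
        \<open>s\<close>, because \<open>x\<close> itself stands before each of them.\<close>
      have *: "(\<forall>y\<in>set (take t w). y < x) \<longleftrightarrow> t \<le> s" if "t \<in> starts w" for t
      proof
        assume a: "\<forall>y\<in>set (take t w). y < x"
        show "t \<le> s"
        proof (rule ccontr)
          assume "\<not> t \<le> s"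
          then have "w ! s \<in> set (take t w)" using sl by (auto intro: nth_in_set_take)
          then show False using a s by auto
        qed
      next
        assume "t \<le> s"
        then have "set (take t w) \<subseteq> set (take s w)" by (simp add: set_take_subset_set_take)
        moreover have "w ! s \<in> set (drop s w)"
          using sl(1) by (rule nth_in_set_drop)
        ultimately show "\<forall>y\<in>set (take t w). y < x" using sl(2) s(2) by (auto simp: is_cut_def)
      qed
      have "x \<in> set w" using s sl by auto
      then have S: "starts (w @ [x]) = {t\<in>starts w. t \<le> s}" unfolding st using * by auto
      have le: "t \<le> s \<longleftrightarrow> w ! t \<le> x" if "t \<in> starts w" for t
        using mono[of s w t] mono[of t w s] that s by (cases t s rule: linorder_cases) auto
      have "(\<lambda>s. (w @ [x]) ! s) ` {t\<in>starts w. t \<le> s} = (\<lambda>s. w ! s) ` {t\<in>starts w. w ! t \<le> x}"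
        by (rule image_cong) (auto simp: starts_def nth_append le)
      also have "\<dots> = {y\<in>opens w. y \<le> x}" using IH by auto
      also have "\<dots> = opens (w @ [x])" using \<open>x \<in> opens w\<close> by (auto simp: opens_snoc)
      finally show ?thesis unfolding S .
    qed
  qed
  ultimately show ?thesis by (simp add: bij_betw_def)
qed

text \<open>An open letter exceeds the first \<open>k\<close> letters iff the component it
  represents starts at \<open>k\<close> or later; \<open>card_starts_cuts\<close> then passes from
  starts to ends.\<close>

lemma card_opens_above:
  assumes "nc M w" "k \<in> cuts w"
  shows "card {x\<in>opens w. \<forall>y\<in>set (take k w). y < x} = card {c\<in>cuts w. k < c}"
proof -
  have b: "inj_on (\<lambda>s. w ! s) (starts w)" "(\<lambda>s. w ! s) ` starts w = opens w"
    using bij_betw_starts_opens[OF assms(1)] by (auto simp: bij_betw_def)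
  have *: "(\<forall>y\<in>set (take k w). y < w ! s) \<longleftrightarrow> k \<le> s" if "s \<in> starts w" for s
  proof
    assume a: "\<forall>y\<in>set (take k w). y < w ! s"
    show "k \<le> s"
    proof (rule ccontr)
      assume "\<not> k \<le> s"
      then have "w ! s \<in> set (take k w)" using that by (auto simp: starts_def intro: nth_in_set_take)
      then show False using a by auto
    qed
  next
    assume "k \<le> s"
    then have "set (take k w) \<subseteq> set (take s w)" by (simp add: set_take_subset_set_take)
    moreover have "w ! s \<in> set (drop s w)"
      using that by (auto simp: starts_def intro: nth_in_set_drop)
    ultimately show "\<forall>y\<in>set (take k w). y < w ! s" using that by (auto simp: is_cut_def starts_def)
  qed
  have "{x\<in>opens w. \<forall>y\<in>set (take k w). y < x} = (\<lambda>s. w ! s) ` {s\<in>starts w. k \<le> s}"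
    unfolding b(2)[symmetric] using * by auto
  then have "card {x\<in>opens w. \<forall>y\<in>set (take k w). y < x} = card {s\<in>starts w. k \<le> s}"
    using b(1) by (simp add: card_image inj_on_subset)
  then show ?thesis using card_starts_cuts[OF assms(2)] by simp
qed

lemma card_opens: "nc M w \<Longrightarrow> card (opens w) = card (cuts w)"
  using bij_betw_same_card[OF bij_betw_starts_opens] card_starts_eq_card_cuts by metis

lemma ncomp_nc: "nc 0 w \<Longrightarrow> ncomp w = card (opens w)"
  using ncomp_eq_card_starts nc_imp_rgf bij_betw_same_card[OF bij_betw_starts_opens] by metis

text \<open>Let \<open>u\<close> be the prefix ending at the last letter used for
  \<open>\<sigma>\<close>, and take \<open>k = mx 0 u\<close>: by \<open>nc_letter_above\<close>,
  the letters used for \<open>\<rho>\<close> exceed not only that last letter but all of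
  \<open>u\<close>. The converse concatenates two occurrences.\<close>

lemma contains_pcat_iff:
  assumes "nc 0 w" "rgf \<sigma>" "rgf \<rho>"
  shows "contains w (pcat \<sigma> \<rho>) \<longleftrightarrow>
    (\<exists>k. contains (takeWhile (\<lambda>x. x \<le> k) w) \<sigma> \<and> contains (filter (\<lambda>x. k < x) w) \<rho>)"
proof -
  have oi: "oiso s (pcat \<sigma> \<rho>) \<longleftrightarrow>
      (\<exists>s1 s2. s = s1 @ s2 \<and> oiso s1 \<sigma> \<and> oiso s2 \<rho> \<and> (\<forall>x\<in>set s1. \<forall>y\<in>set s2. x < y))" for s
    unfolding pcat_def nblocks_mx using mx_ge(1) rgf_ge1[OF assms(3)] by (rule oiso_append)
  show ?thesis
  proof
    assume "contains w (pcat \<sigma> \<rho>)"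
    then obtain s1 s2 where s: "subseq (s1 @ s2) w" "oiso s1 \<sigma>" "oiso s2 \<rho>"
      and lt: "\<forall>x\<in>set s1. \<forall>y\<in>set s2. x < y"
      unfolding contains_iff_subseq oi by blast
    have *: "\<exists>k. contains (takeWhile (\<lambda>x. x \<le> k) w) \<sigma> \<and> contains (filter (\<lambda>x. k < x) w) \<rho>"
      if uv: "w = u @ v" "subseq s1 u" "subseq s2 v" "\<forall>y\<in>set s2. mx 0 u < y" for u v
    proof (intro exI conjI)
      have "takeWhile (\<lambda>x. x \<le> mx 0 u) w = u @ takeWhile (\<lambda>x. x \<le> mx 0 u) v"
        unfolding uv(1) by (rule takeWhile_append2) (rule mx_ge)
      then have "subseq s1 (takeWhile (\<lambda>x. x \<le> mx 0 u) w)" using uv(2) by auto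
      then show "contains (takeWhile (\<lambda>x. x \<le> mx 0 u) w) \<sigma>"
        using s(2) unfolding contains_iff_subseq by blast
      have "filter (\<lambda>x. mx 0 u < x) s2 = s2" using uv(4) by simp
      moreover have "subseq (filter (\<lambda>x. mx 0 u < x) s2) (filter (\<lambda>x. mx 0 u < x) w)"
        using uv by (intro subseq_filter) auto
      ultimately show "contains (filter (\<lambda>x. mx 0 u < x) w) \<rho>"
        using s(3) unfolding contains_iff_subseq by auto
    qed
    show "\<exists>k. contains (takeWhile (\<lambda>x. x \<le> k) w) \<sigma> \<and> contains (filter (\<lambda>x. k < x) w) \<rho>"
    proof (cases s1 rule: rev_cases)
      \<comment> \<open>With nothing used for \<open>\<sigma>\<close>, the cut is
        \<open>k = 0\<close>, below every letter.\<close>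
      case Nil
      have "\<forall>y\<in>set s2. 0 < y"
        using set_subseq[OF s(1)] rgf_ge1[OF nc_imp_rgf[OF assms(1)]] by fastforce
      then show ?thesis using *[of "[]" w] s(1) Nil by simp
    next
      case (snoc s a)
      then have "subseq (s @ a # s2) w" using s(1) by simp
      then obtain u v where uv: "w = u @ v" "subseq s u" "subseq (a # s2) v"
        using list_emb_appendD by blast
      then obtain us vs where v: "v = us @ a # vs" "subseq s2 vs"
        using list_emb_ConsD[OF uv(3)] by blast
      let ?u = "u @ us @ [a]"
      have w: "w = ?u @ vs" using uv v by simp
      have "subseq (s @ [a]) (u @ us @ [a])" using uv(2) by (intro list_emb_append_mono) auto
      moreover have "\<forall>y\<in>set s2. mx 0 ?u < y"
      proof
        fix y assume y: "y \<in> set s2"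
        show "mx 0 ?u < y"
        proof (rule nc_letter_above)
          show "nc 0 (?u @ vs)" using assms(1) w by simp
          show "y \<in> set vs" using y v(2) set_subseq by blast
          show "last ?u < y" using lt snoc y by simp
        qed simp
      qed
      ultimately show ?thesis using *[OF w] v(2) snoc by blast
    qed
  next
    assume "\<exists>k. contains (takeWhile (\<lambda>x. x \<le> k) w) \<sigma> \<and> contains (filter (\<lambda>x. k < x) w) \<rho>"
    then obtain k s1 s2 where s1: "subseq s1 (takeWhile (\<lambda>x. x \<le> k) w)" "oiso s1 \<sigma>"
      and s2: "subseq s2 (filter (\<lambda>x. k < x) w)" "oiso s2 \<rho>"
      unfolding contains_iff_subseq by blast
    let ?d = "dropWhile (\<lambda>x. x \<le> k) w"
    \<comment> \<open>Letters above \<open>k\<close> occur only after the prefix, so an occurrence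
      of \<open>\<rho>\<close> among them follows the one of \<open>\<sigma>\<close>.\<close>
    have "filter (\<lambda>x. k < x) w = filter (\<lambda>x. k < x) (takeWhile (\<lambda>x. x \<le> k) w @ ?d)" by simp
    also have "\<dots> = filter (\<lambda>x. k < x) ?d"
      unfolding filter_append by (auto simp: filter_empty_conv dest!: set_takeWhileD)
    finally have "subseq s2 ?d" using s2(1) subseq_order.trans subseq_filter_left by metis
    then have "subseq (s1 @ s2) (takeWhile (\<lambda>x. x \<le> k) w @ ?d)"
      using s1(1) by (intro list_emb_append_mono)
    moreover have "\<forall>x\<in>set s1. \<forall>y\<in>set s2. x < y"
      using set_subseq[OF s1(1)] set_subseq[OF s2(1)] by (fastforce dest: set_takeWhileD)
    ultimately show "contains w (pcat \<sigma> \<rho>)"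
      using s1(2) s2(2) unfolding contains_iff_subseq oi takeWhile_dropWhile_id by blast
  qed
qed

section \<open>Chains in a product of two finite linear orders\<close>

text \<open>Repetitions are allowed: these are the multichains in the product of the reversed
  \<open>P\<close> with \<open>Q\<close>. In the application, inserted old letters weakly descend
  through \<open>P\<close> while insertion points weakly advance through \<open>Q\<close>.\<close>

definition stair_chains :: "nat set \<Rightarrow> nat set \<Rightarrow> (nat \<times> nat) list set" where
  "stair_chains P Q = {xs. set xs \<subseteq> P \<times> Q \<and>
    sorted_wrt (\<lambda>z z'. fst z' \<le> fst z \<and> snd z \<le> snd z') xs}"

text \<open>Predicts the number of components after gluing. Only the last insertion counts: a letter
  \<open>b\<close> inserted after \<open>k\<close> new ones leaves the open letters up to
  \<open>b\<close> and the upper components ending beyond \<open>k\<close>.\<close>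

definition chain_comp :: "nat set \<Rightarrow> nat set \<Rightarrow> (nat \<times> nat) list \<Rightarrow> nat" where
  "chain_comp P Q xs = (if xs = [] then card P + card Q
    else card {p\<in>P. p \<le> fst (last xs)} + card {q\<in>Q. snd (last xs) < q})"

text \<open>The largest element of \<open>P\<close> goes to the least element of \<open>Q\<close>,
  and induction treats the rest.\<close>

lemma ex_antimono_bij:
  fixes P Q :: "nat set"
  assumes "finite P" "finite Q" "card P = card Q"
  shows "\<exists>f. bij_betw f P Q \<and> (\<forall>x\<in>P. \<forall>y\<in>P. x < y \<longrightarrow> f y < f x)"
  using assms
proof (induction P arbitrary: Q rule: finite_linorder_max_induct)
  case empty
  then show ?case by (auto simp: bij_betw_def)
next
  case (insert b A)
  then have "Q \<noteq> {}" by auto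
  let ?q = "Min Q"
  have b: "b \<notin> A" using insert by auto
  have "card A = card (Q - {?q})" using insert b \<open>Q \<noteq> {}\<close> by auto
  then obtain f where f: "bij_betw f A (Q - {?q})" "\<forall>x\<in>A. \<forall>y\<in>A. x < y \<longrightarrow> f y < f x"
    using insert.IH[of "Q - {?q}"] insert.prems by auto
  have "bij_betw (f(b := ?q)) (insert b A) (insert ?q (Q - {?q}))"
  proof -
    have "bij_betw (f(b := ?q)) A (Q - {?q}) \<longleftrightarrow> bij_betw f A (Q - {?q})"
      using b by (intro bij_betw_cong) auto
    then show ?thesis using f(1) b notIn_Un_bij_betw[of b A "f(b := ?q)" "Q - {?q}"] by simp
  qed
  moreover have "insert ?q (Q - {?q}) = Q"
    using Min_in[OF insert.prems(1) \<open>Q \<noteq> {}\<close>] by (rule insert_Diff)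
  moreover have q: "?q < f x" if "x \<in> A" for x
  proof -
    have "f x \<in> Q" "f x \<noteq> ?q" using that f(1) by (auto simp: bij_betw_def)
    then show ?thesis using insert.prems by (simp add: le_neq_implies_less)
  qed
  moreover have "(f(b := ?q)) y < (f(b := ?q)) x" if "x \<in> insert b A" "y \<in> insert b A" "x < y" for x y
    using that f(2) q insert.hyps(2) by (auto dest: less_asym)
  ultimately show ?case by (intro exI[of _ "f(b := ?q)"]) (simp del: fun_upd_apply)
qed

text \<open>Transposing a chain and reversing both orders exchanges the two factors.\<close>

lemma card_chains_le:
  assumes fin: "finite P" "finite Q" "finite P'" "finite Q'"
    and card: "card P = card Q'" "card Q = card P'"
  shows "card {xs\<in>stair_chains P Q. N + length xs = n \<and> chain_comp P Q xs = m} \<le>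
    card {xs\<in>stair_chains P' Q'. N + length xs = n \<and> chain_comp P' Q' xs = m}" (is "card ?A \<le> card ?B")
proof -
  obtain f where f: "bij_betw f P Q'" "\<forall>x\<in>P. \<forall>y\<in>P. x < y \<longrightarrow> f y < f x"
    using ex_antimono_bij[of P Q'] assms by blast
  obtain g where g: "bij_betw g Q P'" "\<forall>x\<in>Q. \<forall>y\<in>Q. x < y \<longrightarrow> g y < g x"
    using ex_antimono_bij[of Q P'] assms by blast
  have f_le: "x \<le> y \<longleftrightarrow> f y \<le> f x" if "x \<in> P" "y \<in> P" for x y
    using f(2) that by (cases x y rule: linorder_cases) (auto simp: not_le less_imp_le)
  have g_le: "x \<le> y \<longleftrightarrow> g y \<le> g x" if "x \<in> Q" "y \<in> Q" for x y
    using g(2) that by (cases x y rule: linorder_cases) (auto simp: not_le less_imp_le)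
  have inj: "inj_on f P" "inj_on g Q" and im: "f ` P = Q'" "g ` Q = P'"
    using f(1) g(1) by (auto simp: bij_betw_def)
  let ?F = "map (\<lambda>z. (g (snd z), f (fst z)))"
  have "inj_on ?F ?A"
  proof (rule inj_onI)
    fix xs ys assume "xs \<in> ?A" "ys \<in> ?A" and eq: "?F xs = ?F ys"
    then have "set xs \<union> set ys \<subseteq> P \<times> Q" by (auto simp: stair_chains_def)
    moreover have "inj_on (\<lambda>z. (g (snd z), f (fst z))) (P \<times> Q)"
      using inj by (intro inj_onI) (auto dest: inj_onD)
    ultimately have "inj_on (\<lambda>z. (g (snd z), f (fst z))) (set xs \<union> set ys)"
      by (rule inj_on_subset[rotated])
    then show "xs = ys" using eq by (rule map_inj_on[rotated])
  qed
  moreover have "?F ` ?A \<subseteq> ?B"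
  proof (intro image_subsetI)
    fix xs assume "xs \<in> ?A"
    then have xs: "set xs \<subseteq> P \<times> Q" "sorted_wrt (\<lambda>z z'. fst z' \<le> fst z \<and> snd z \<le> snd z') xs"
      "N + length xs = n" "chain_comp P Q xs = m" by (auto simp: stair_chains_def)
    have "set (?F xs) \<subseteq> P' \<times> Q'" using xs(1) im by auto
    moreover have "sorted_wrt (\<lambda>z z'. fst z' \<le> fst z \<and> snd z \<le> snd z') (?F xs)"
      unfolding sorted_wrt_map
      using xs(2)
    proof (rule sorted_wrt_mono_rel[rotated])
      fix z z' assume "z \<in> set xs" "z' \<in> set xs" "fst z' \<le> fst z \<and> snd z \<le> snd z'"
      moreover from this have "fst z \<in> P" "fst z' \<in> P" "snd z \<in> Q" "snd z' \<in> Q"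
        using xs(1) by auto
      ultimately show "fst (g (snd z'), f (fst z')) \<le> fst (g (snd z), f (fst z)) \<and>
          snd (g (snd z), f (fst z)) \<le> snd (g (snd z'), f (fst z'))"
        using f_le g_le by auto
    qed
    moreover have "chain_comp P' Q' (?F xs) = m"
    proof (cases "xs = []")
      case True
      then show ?thesis using xs(4) card by (simp add: chain_comp_def)
    next
      case False
      obtain b k where bk: "last xs = (b, k)" by force
      then have "(b, k) \<in> set xs" using False last_in_set by metis
      then have b: "b \<in> P" and k: "k \<in> Q" using xs(1) by auto
      \<comment> \<open>Reflection turns \<open>p \<le> g k\<close> into \<open>k \<le> q\<close>
        and \<open>f b < q\<close> into \<open>p < b\<close>: the count in \<open>Q\<close> gains
        \<open>k\<close> while the count in \<open>P\<close> loses \<open>b\<close>, so the sum is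
        unchanged.\<close>
      have "{p\<in>P'. p \<le> g k} = g ` {q\<in>Q. k \<le> q}" using im(2) g_le k by auto
      then have 1: "card {p\<in>P'. p \<le> g k} = card {q\<in>Q. k \<le> q}"
        using inj(2) by (simp add: card_image inj_on_subset)
      have "{q\<in>Q'. f b < q} = f ` {p\<in>P. p < b}"
        using im(1) f_le b by (auto simp: not_le[symmetric])
      then have 2: "card {q\<in>Q'. f b < q} = card {p\<in>P. p < b}"
        using inj(1) by (simp add: card_image inj_on_subset)
      have "{q\<in>Q. k \<le> q} = insert k {q\<in>Q. k < q}" using k by auto
      then have 3: "card {q\<in>Q. k \<le> q} = Suc (card {q\<in>Q. k < q})" using fin by simp
      have "{p\<in>P. p \<le> b} = insert b {p\<in>P. p < b}" using b by auto
      then have 4: "card {p\<in>P. p \<le> b} = Suc (card {p\<in>P. p < b})" using fin by simp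
      show ?thesis using xs(4) False bk 1 2 3 4 by (simp add: chain_comp_def last_map)
    qed
    ultimately show "?F xs \<in> ?B" using xs(3) by (simp add: stair_chains_def)
  qed
  moreover have "finite ?B"
    by (rule finite_subset[OF _ finite_lists_length_eq[of "P' \<times> Q'" "n - N"]])
      (auto simp: stair_chains_def fin)
  ultimately show ?thesis by (rule card_inj_on_le)
qed

text \<open>The hypotheses are symmetric, so the inequality applies in both directions.
  \<open>N\<close> will be the combined length of the two glued words.\<close>

lemma card_chains_swap:
  assumes "finite P" "finite Q" "finite P'" "finite Q'" "card P = card Q'" "card Q = card P'"
  shows "card {xs\<in>stair_chains P Q. N + length xs = n \<and> chain_comp P Q xs = m} =
    card {xs\<in>stair_chains P' Q'. N + length xs = n \<and> chain_comp P' Q' xs = m}"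
  using assms by (intro antisym card_chains_le) auto

section \<open>Gluing two non-crossing words\<close>

text \<open>Let \<open>\<alpha> @ r\<close> be non-crossing, where \<open>r\<close> is empty or starts with a new letter. The letters of
  \<open>r\<close> that are new form a non-crossing word \<open>\<beta>\<close>. An old letter \<open>b\<close> can be inserted after the
  \<open>k\<close>-th letter of \<open>\<beta>\<close> iff \<open>b\<close> is still open and \<open>k\<close> is the end of a component of \<open>\<beta>\<close>, and each
  inserted letter closes everything opened after it. So the insertions are exactly the chains in
  \<open>opens \<alpha> \<times> cuts \<beta>\<close>.\<close>

fun olds :: "nat \<Rightarrow> nat \<Rightarrow> nat list \<Rightarrow> (nat \<times> nat) list" where
  "olds M k [] = []"
| "olds M k (x # r) = (if x \<le> M then (x, k) # olds M k r else olds M (Suc k) r)"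

lemma olds_snoc:
  "olds M k (r @ [x]) =
    olds M k r @ (if x \<le> M then [(x, k + length (filter (\<lambda>x. M < x) r))] else [])"
  by (induction r arbitrary: k) auto

lemma length_olds: "length (filter (\<lambda>x. M < x) r) + length (olds M k r) = length r"
  by (induction r arbitrary: k) auto

lemma olds_bounds:
  "z \<in> set (olds M k r) \<Longrightarrow>
    fst z \<le> M \<and> k \<le> snd z \<and> snd z \<le> k + length (filter (\<lambda>x. M < x) r)"
  by (induction r arbitrary: k) (force split: if_splits)+

text \<open>Each pair records an old letter and the number of new letters before it, counted from
  \<open>k\<close>. If the words began with letters of different kinds, one list would contain
  counter \<open>k\<close> while the other counts from \<open>Suc k\<close>.\<close>

lemma olds_inj:
  "filter (\<lambda>x. M < x) r = filter (\<lambda>x. M < x) r' \<Longrightarrow> olds M k r = olds M k r' \<Longrightarrow> r = r'"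
proof (induction r arbitrary: k r')
  case Nil
  then have "length r' = 0" using length_olds[of M r' k] by simp
  then show ?case by simp
next
  case (Cons x r)
  have "length r' = length (x # r)"
    using Cons.prems length_olds[of M "x # r" k] length_olds[of M r' k] by simp
  then obtain y s where r': "r' = y # s" by (cases r') auto
  consider "x \<le> M" "y \<le> M" | "M < x" "M < y" | "x \<le> M" "M < y" | "M < x" "y \<le> M" by linarith
  then show ?case
  proof cases
    case 1
    then show ?thesis using Cons.prems Cons.IH[of s k] r' by auto
  next
    case 2
    then show ?thesis using Cons.prems Cons.IH[of s "Suc k"] r' by auto
  next
    case 3
    then have "(x, k) \<in> set (olds M (Suc k) s)"
      using Cons.prems(2) r' by (metis list.set_intros(1) not_le olds.simps(2))
    then show ?thesis using olds_bounds by fastforce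
  next
    case 4
    then have "(y, k) \<in> set (olds M (Suc k) r)"
      using Cons.prems(2) r' by (metis list.set_intros(1) not_le olds.simps(2))
    then show ?thesis using olds_bounds by fastforce
  qed
qed

text \<open>Merge greedily: emit the first pair while its counter equals \<open>k\<close>, otherwise
  emit the next letter of \<open>\<beta>\<close> and raise \<open>k\<close>.\<close>

lemma olds_surj:
  assumes "\<forall>x\<in>set \<beta>. M < x" "\<forall>z\<in>set xs. fst z \<le> M \<and> snd z \<le> k + length \<beta> \<and> k \<le> snd z"
    "sorted_wrt (\<lambda>z z'. snd z \<le> snd z') xs"
  shows "\<exists>r. filter (\<lambda>x. M < x) r = \<beta> \<and> olds M k r = xs"
  using assms
proof (induction "length \<beta> + length xs" arbitrary: \<beta> xs k rule: less_induct)
  case less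
  show ?case
  proof (cases "xs \<noteq> [] \<and> snd (hd xs) = k")
    case True
    then obtain b ys where xs: "xs = (b, k) # ys" by (cases xs) auto
    have "\<exists>r. filter (\<lambda>x. M < x) r = \<beta> \<and> olds M k r = ys"
      using less.prems xs by (intro less.hyps) auto
    then obtain r where r: "filter (\<lambda>x. M < x) r = \<beta>" "olds M k r = ys" by blast
    have "b \<le> M" using less.prems(2) xs by simp
    then show ?thesis using r xs by (intro exI[of _ "b # r"]) auto
  next
    case False
    have gt: "Suc k \<le> snd z" if "z \<in> set xs" for z
    proof (cases xs)
      case (Cons z0 ys)
      then have "k < snd z0" using False less.prems(2) by (auto simp: le_less)
      moreover have "snd z0 \<le> snd z" using Cons less.prems(3) that by auto
      ultimately show ?thesis by simp
    qed (use that in simp)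
    show ?thesis
    proof (cases \<beta>)
      case Nil
      have "xs = []"
      proof (cases xs)
        case (Cons z ys)
        then show ?thesis using gt[of z] less.prems(2) Nil by auto
      qed
      then show ?thesis using Nil by (intro exI[of _ "[]"]) simp
    next
      case (Cons y \<beta>')
      have "\<exists>r. filter (\<lambda>x. M < x) r = \<beta>' \<and> olds M (Suc k) r = xs"
        using less.prems Cons gt by (intro less.hyps) auto
      then obtain r where "filter (\<lambda>x. M < x) r = \<beta>'" "olds M (Suc k) r = xs" by blast
      then show ?thesis using less.prems(1) Cons by (intro exI[of _ "y # r"]) auto
    qed
  qed
qed

lemma cuts_snoc:
  "cuts (w @ [x]) = {k\<in>cuts w. \<forall>y\<in>set (take k w). y < x} \<union> {Suc (length w)}"
  by (auto simp: cuts_def is_cut_def le_Suc_eq)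

lemma mx_filter: "mx M (filter (\<lambda>x. M < x) r) = mx M r"
proof (induction r rule: rev_induct)
  case (snoc x r)
  then show ?case using mx_ge(2)[of M r] by auto
qed simp

lemma chains_snoc:
  "xs @ [z] \<in> stair_chains P Q \<longleftrightarrow>
    xs \<in> stair_chains P Q \<and> z \<in> P \<times> Q \<and> (\<forall>z'\<in>set xs. fst z \<le> fst z' \<and> snd z' \<le> snd z)"
  by (auto simp: stair_chains_def sorted_wrt_append)

lemma chains_last:
  assumes "xs \<in> stair_chains P Q" "z \<in> set xs"
  shows "fst (last xs) \<le> fst z \<and> snd z \<le> snd (last xs)"
  using assms by (cases xs rule: rev_cases) (auto simp: chains_snoc)

text \<open>The stack whose size \<open>chain_comp\<close> predicts.\<close>

definition glued_opens :: "nat list \<Rightarrow> nat list \<Rightarrow> (nat \<times> nat) list \<Rightarrow> nat set" where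
  "glued_opens \<alpha> \<beta> xs = (if xs = [] then opens \<alpha> \<union> opens \<beta>
    else {x\<in>opens \<alpha>. x \<le> fst (last xs)} \<union>
      {x\<in>opens \<beta>. \<forall>y\<in>set (take (snd (last xs)) \<beta>). y < x})"

text \<open>Validity and the resulting stack need one joint induction, as the stack decides which
  letter may come next. The condition on \<open>hd r\<close> says that \<open>\<alpha>\<close> is
  the whole initial run of letters up to \<open>M\<close>.\<close>

lemma nc_glue:
  fixes \<alpha> r
  defines "M \<equiv> mx 0 \<alpha>"
  defines "\<beta> \<equiv> filter (\<lambda>x. M < x) r"
  assumes "nc 0 \<alpha>"
  shows "(nc 0 (\<alpha> @ r) \<and> (r = [] \<or> M < hd r) \<longleftrightarrow>
      nc M \<beta> \<and> olds M 0 r \<in> stair_chains (opens \<alpha>) (cuts \<beta>)) \<and>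
    (nc 0 (\<alpha> @ r) \<and> (r = [] \<or> M < hd r) \<longrightarrow>
      opens (\<alpha> @ r) = glued_opens \<alpha> \<beta> (olds M 0 r))"
  unfolding \<beta>_def
proof (induction r rule: rev_induct)
  case Nil
  show ?case using assms by (simp add: stair_chains_def glued_opens_def)
next
  case (snoc x r)
  have opM: "y \<le> M" if "y \<in> opens \<alpha>" for y
    using that opens_subset mx_ge(1)[of y \<alpha> 0] unfolding M_def by blast
  have ncx: "nc 0 (\<alpha> @ r @ [x]) \<longleftrightarrow> nc 0 (\<alpha> @ r) \<and> (x = Suc (mx M r) \<or> x \<in> opens (\<alpha> @ r))"
    using nc_snoc[of 0 "\<alpha> @ r" x] by (simp add: mx_append M_def)
  have opx: "opens (\<alpha> @ r @ [x]) = insert x {y\<in>opens (\<alpha> @ r). y < x}"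
    using opens_snoc[of "\<alpha> @ r" x] by simp
  show ?case
  proof (cases "r = []")
    case True
    show ?thesis
    proof (cases "M < x")
      case True
      have "{y\<in>opens \<alpha>. y < x} = opens \<alpha>" "x \<notin> opens \<alpha>" using opM True by force+
      moreover have "nc M [x] \<longleftrightarrow> x = Suc M" "opens [x] = {x}"
        using nc_snoc[of M "[]" x] opens_snoc[of "[]" x] by auto
      ultimately show ?thesis
        using \<open>r = []\<close> True assms(3) ncx opx
        by (cases "x = Suc M") (simp_all add: stair_chains_def glued_opens_def)
    next
      case False
      \<comment> \<open>An old first letter would be recorded with counter \<open>0\<close>, which
        is never a cut.\<close>
      then show ?thesis using \<open>r = []\<close> by (simp add: stair_chains_def cuts_def)
    qed
  next
    case False
    let ?b = "filter (\<lambda>x. M < x) r" and ?xs = "olds M 0 r"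
    let ?L = "nc 0 (\<alpha> @ r) \<and> M < hd r"
    let ?R = "nc M ?b \<and> ?xs \<in> stair_chains (opens \<alpha>) (cuts ?b)"
    have hd: "r @ [x] = [] \<or> M < hd (r @ [x]) \<longleftrightarrow> M < hd r" using False by simp
    have IH: "?L \<longleftrightarrow> ?R" "?L \<Longrightarrow> opens (\<alpha> @ r) = glued_opens \<alpha> ?b ?xs" using snoc False by auto
    have snd_le: "snd z \<le> length ?b" if "z \<in> set ?xs" for z using olds_bounds[OF that] by simp
    have opb: "y \<in> set ?b" "M < y" if "y \<in> opens ?b" for y
      using that opens_subset[of ?b] by auto
    show ?thesis
    proof (cases "x \<le> M")
      case True
      then have f: "filter (\<lambda>x. M < x) (r @ [x]) = ?b"
        and o: "olds M 0 (r @ [x]) = ?xs @ [(x, length ?b)]" by (auto simp: olds_snoc)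
      have x: "x \<noteq> Suc (mx M r)" "x \<notin> opens ?b"
        using True mx_ge(2)[of M r] opb(2)[of x] by auto
      \<comment> \<open>The end of \<open>?b\<close> is always a cut, so the real condition is that
        \<open>x\<close> is open in \<open>\<alpha>\<close> and does not exceed the last inserted
        letter.\<close>
      have step: "x \<in> opens (\<alpha> @ r) \<longleftrightarrow>
          (x, length ?b) \<in> opens \<alpha> \<times> cuts ?b \<and> (\<forall>z\<in>set ?xs. x \<le> fst z \<and> snd z \<le> length ?b)"
        if L: ?L
      proof -
        have "?b \<noteq> []" using False L by (cases r) auto
        then have "length ?b \<in> cuts ?b" by (simp add: cuts_def is_cut_def)
        moreover have "(\<forall>z\<in>set ?xs. x \<le> fst z) \<longleftrightarrow> ?xs = [] \<or> x \<le> fst (last ?xs)"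
        proof (cases "?xs = []")
          case xs: False
          have "?xs \<in> stair_chains (opens \<alpha>) (cuts ?b)" using L IH(1) by blast
          then show ?thesis
            using xs last_in_set[OF xs] chains_last by (meson order_trans)
        qed simp
        ultimately show ?thesis
          unfolding IH(2)[OF L] glued_opens_def using x(2) snd_le by auto
      qed
      have op: "opens (\<alpha> @ r @ [x]) = glued_opens \<alpha> ?b (?xs @ [(x, length ?b)])"
        if L: ?L and xo: "x \<in> opens (\<alpha> @ r)"
      proof -
        have "{y\<in>opens ?b. \<forall>z\<in>set ?b. z < y} = {}" using opb(1) by blast
        moreover have "y \<in> opens (\<alpha> @ r) \<and> y < x \<longleftrightarrow> y \<in> opens \<alpha> \<and> y < x" for y
        proof -
          have "?xs = [] \<or> x \<le> fst (last ?xs)" using step[OF L] xo last_in_set[of ?xs] by blast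
          moreover have "y \<notin> opens ?b" if "y < x" using that True opb(2)[of y] by auto
          ultimately show ?thesis unfolding IH(2)[OF L] glued_opens_def by auto
        qed
        moreover have "x \<in> opens \<alpha>" using step[OF L] xo by auto
        ultimately show ?thesis unfolding opx glued_opens_def by auto
      qed
      show ?thesis
        unfolding f o hd ncx chains_snoc fst_conv snd_conv using IH(1) step op x(1) by blast
    next
      case False
      then have f: "filter (\<lambda>x. M < x) (r @ [x]) = ?b @ [x]"
        and o: "olds M 0 (r @ [x]) = ?xs" by (auto simp: olds_snoc)
      have new: "y < x" if "x = Suc (mx M r)" "y \<in> set ?b" for y
        using mx_ge(1)[OF that(2), of M] that(1) by (simp add: mx_filter)
      have lt: "y < x" if "y \<in> opens \<alpha>" for y using False opM[OF that] by simp
      have xa: "x \<notin> opens \<alpha>" using False opM by auto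
      \<comment> \<open>Positions weakly increase along the chain, so the longest prefix, belonging
        to the last entry, decides.\<close>
      have last: "(\<forall>z\<in>set ?xs. \<forall>y\<in>set (take (snd z) ?b). y < x) \<longleftrightarrow>
          ?xs = [] \<or> (\<forall>y\<in>set (take (snd (last ?xs)) ?b). y < x)" if L: ?L
      proof
        assume "\<forall>z\<in>set ?xs. \<forall>y\<in>set (take (snd z) ?b). y < x"
        then show "?xs = [] \<or> (\<forall>y\<in>set (take (snd (last ?xs)) ?b). y < x)"
          using last_in_set by blast
      next
        assume a: "?xs = [] \<or> (\<forall>y\<in>set (take (snd (last ?xs)) ?b). y < x)"
        show "\<forall>z\<in>set ?xs. \<forall>y\<in>set (take (snd z) ?b). y < x"
        proof (intro ballI)
          fix z y assume z: "z \<in> set ?xs" and y: "y \<in> set (take (snd z) ?b)"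
          have "snd z \<le> snd (last ?xs)"
            using chains_last[of ?xs "opens \<alpha>" "cuts ?b" z] z L IH(1) by blast
          then have "y \<in> set (take (snd (last ?xs)) ?b)"
            using y set_take_subset_set_take[of "snd z" "snd (last ?xs)" ?b] by blast
          then show "y < x" using a z by auto
        qed
      qed
      \<comment> \<open>A letter above \<open>M\<close> is admissible iff it is admissible for
        \<open>?b\<close> alone and no insertion has popped it; the latter amounts to keeping every
        recorded cut.\<close>
      have step: "x = Suc (mx M r) \<or> x \<in> opens (\<alpha> @ r) \<longleftrightarrow> (x = Suc (mx M ?b) \<or> x \<in> opens ?b) \<and>
          (\<forall>z\<in>set ?xs. \<forall>y\<in>set (take (snd z) ?b). y < x)" if L: ?L
      proof -
        have "x = Suc (mx M r) \<Longrightarrow> \<forall>y\<in>set (take (snd (last ?xs)) ?b). y < x"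
          using new in_set_takeD[of _ "snd (last ?xs)" ?b] by blast
        then show ?thesis
          unfolding IH(2)[OF L] last[OF L] glued_opens_def mx_filter using xa by auto
      qed
      \<comment> \<open>No recorded pair uses the cut that \<open>x\<close> adds at the end, since
        counters are at most \<open>length ?b\<close>.\<close>
      have ch: "?xs \<in> stair_chains (opens \<alpha>) (cuts (?b @ [x])) \<longleftrightarrow>
          ?xs \<in> stair_chains (opens \<alpha>) (cuts ?b) \<and> (\<forall>z\<in>set ?xs. \<forall>y\<in>set (take (snd z) ?b). y < x)"
      proof -
        have "snd z \<in> cuts (?b @ [x]) \<longleftrightarrow>
            snd z \<in> cuts ?b \<and> (\<forall>y\<in>set (take (snd z) ?b). y < x)" if "z \<in> set ?xs" for z
          using snd_le[OF that] unfolding cuts_snoc by auto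
        then show ?thesis unfolding stair_chains_def by (auto simp: subset_iff mem_Times_iff)
      qed
      have op: "opens (\<alpha> @ r @ [x]) = glued_opens \<alpha> (?b @ [x]) ?xs"
        if L: ?L and xo: "x = Suc (mx M r) \<or> x \<in> opens (\<alpha> @ r)"
      proof (cases "?xs = []")
        case True
        then show ?thesis
          unfolding opx IH(2)[OF L] glued_opens_def opens_snoc using lt by auto
      next
        case xs: False
        have k: "take (snd (last ?xs)) (?b @ [x]) = take (snd (last ?xs)) ?b"
          using snd_le[OF last_in_set[OF xs]] by simp
        have "\<forall>y\<in>set (take (snd (last ?xs)) ?b). y < x" using step[OF L] last[OF L] xo xs by blast
        then show ?thesis
          unfolding opx IH(2)[OF L] glued_opens_def opens_snoc k using xs lt by auto
      qed
      show ?thesis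
        unfolding f o hd ncx ch nc_snoc[of M ?b] using IH(1) step op by blast
    qed
  qed
qed

section \<open>Words with prescribed prefix and upper subword\<close>

definition glue :: "nat list \<Rightarrow> nat list \<Rightarrow> nat list set" where
  "glue \<alpha> \<beta> = {w. nc 0 w \<and> takeWhile (\<lambda>x. x \<le> mx 0 \<alpha>) w = \<alpha> \<and>
    filter (\<lambda>x. mx 0 \<alpha> < x) w = map (\<lambda>x. x + mx 0 \<alpha>) \<beta>}"

definition cnt :: "nat list set \<Rightarrow> nat \<Rightarrow> nat \<Rightarrow> nat" where
  "cnt A n m = card {w\<in>A. length w = n \<and> ncomp w = m}"

lemma glue_iff:
  assumes "nc 0 \<alpha>" "nc 0 \<beta>"
  shows "w \<in> glue \<alpha> \<beta> \<longleftrightarrow> (\<exists>r. w = \<alpha> @ r \<and>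
    filter (\<lambda>x. mx 0 \<alpha> < x) r = map (\<lambda>x. x + mx 0 \<alpha>) \<beta> \<and>
    olds (mx 0 \<alpha>) 0 r \<in> stair_chains (opens \<alpha>) (cuts \<beta>))"
proof -
  let ?M = "mx 0 \<alpha>"
  have f\<alpha>: "filter (\<lambda>x. ?M < x) \<alpha> = []" using mx_ge(1) by (auto simp: filter_empty_conv not_less)
  show ?thesis
  proof
    assume w: "w \<in> glue \<alpha> \<beta>"
    let ?r = "dropWhile (\<lambda>x. x \<le> ?M) w"
    have wr: "w = \<alpha> @ ?r" using w takeWhile_dropWhile_id[of "\<lambda>x. x \<le> ?M" w] by (simp add: glue_def)
    have "filter (\<lambda>x. ?M < x) (\<alpha> @ ?r) = map (\<lambda>x. x + ?M) \<beta>"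
      using w wr by (simp add: glue_def)
    then have fr: "filter (\<lambda>x. ?M < x) ?r = map (\<lambda>x. x + ?M) \<beta>" by (simp add: f\<alpha>)
    have "?r = [] \<or> ?M < hd ?r" using hd_dropWhile[of "\<lambda>x. x \<le> ?M" w] not_le by blast
    moreover have "nc 0 (\<alpha> @ ?r)" using w wr by (simp add: glue_def)
    ultimately have "olds ?M 0 ?r \<in> stair_chains (opens \<alpha>) (cuts \<beta>)"
      using nc_glue[OF assms(1), of ?r] unfolding fr by simp
    then show "\<exists>r. w = \<alpha> @ r \<and> filter (\<lambda>x. ?M < x) r = map (\<lambda>x. x + ?M) \<beta> \<and>
        olds ?M 0 r \<in> stair_chains (opens \<alpha>) (cuts \<beta>)"
      using wr fr by blast
  next
    assume "\<exists>r. w = \<alpha> @ r \<and> filter (\<lambda>x. ?M < x) r = map (\<lambda>x. x + ?M) \<beta> \<and>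
        olds ?M 0 r \<in> stair_chains (opens \<alpha>) (cuts \<beta>)"
    then obtain r where r: "w = \<alpha> @ r" "filter (\<lambda>x. ?M < x) r = map (\<lambda>x. x + ?M) \<beta>"
      "olds ?M 0 r \<in> stair_chains (opens \<alpha>) (cuts \<beta>)" by blast
    have nc: "nc 0 (\<alpha> @ r) \<and> (r = [] \<or> ?M < hd r)"
      using nc_glue[OF assms(1), of r] r assms(2) by simp
    have "takeWhile (\<lambda>x. x \<le> ?M) (\<alpha> @ r) = \<alpha> @ takeWhile (\<lambda>x. x \<le> ?M) r"
      by (rule takeWhile_append2) (rule mx_ge)
    also have "takeWhile (\<lambda>x. x \<le> ?M) r = []" using nc by (cases r) auto
    finally show "w \<in> glue \<alpha> \<beta>" using nc r f\<alpha> by (simp add: glue_def)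
  qed
qed

text \<open>The stacks of the two parts are separated by \<open>mx 0 \<alpha>\<close>, so
  \<open>glued_opens\<close> is counted part by part; \<open>card_opens_above\<close> evaluates the
  upper part.\<close>

lemma ncomp_glue:
  assumes "nc 0 \<alpha>" "nc 0 \<beta>" "\<alpha> @ r \<in> glue \<alpha> \<beta>"
  shows "ncomp (\<alpha> @ r) = chain_comp (opens \<alpha>) (cuts \<beta>) (olds (mx 0 \<alpha>) 0 r)"
proof -
  let ?M = "mx 0 \<alpha>" and ?\<beta> = "map (\<lambda>x. x + mx 0 \<alpha>) \<beta>"
  let ?xs = "olds ?M 0 r"
  have r: "filter (\<lambda>x. ?M < x) r = ?\<beta>" "?xs \<in> stair_chains (opens \<alpha>) (cuts ?\<beta>)"
    using assms(3) unfolding glue_iff[OF assms(1,2)] by auto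
  have nc: "nc 0 (\<alpha> @ r)" using assms(3) by (simp add: glue_def)
  have nc\<beta>: "nc ?M ?\<beta>" using assms(2) by simp
  have "ncomp (\<alpha> @ r) = card (glued_opens \<alpha> ?\<beta> ?xs)"
    using nc_glue[OF assms(1), of r] r nc\<beta> ncomp_nc[OF nc] by auto
  also have "\<dots> = chain_comp (opens \<alpha>) (cuts ?\<beta>) ?xs"
  proof -
    have "opens \<alpha> \<subseteq> {..?M}"
      using opens_subset mx_ge(1) by fastforce
    moreover have "opens ?\<beta> \<subseteq> {?M<..}"
      using opens_subset[of ?\<beta>] set_nc[OF nc\<beta>] by auto
    ultimately have dis: "opens \<alpha> \<inter> opens ?\<beta> = {}" by force
    show ?thesis
    proof (cases "?xs = []")
      case True
      then show ?thesis
        using dis card_opens[OF nc\<beta>] by (simp add: glued_opens_def chain_comp_def card_Un_disjoint)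
    next
      case False
      then have "last ?xs \<in> opens \<alpha> \<times> cuts ?\<beta>" using r(2) last_in_set by (auto simp: stair_chains_def)
      then have "snd (last ?xs) \<in> cuts ?\<beta>" by (rule mem_Times_iff[THEN iffD1, THEN conjunct2])
      then have "card {x\<in>opens ?\<beta>. \<forall>y\<in>set (take (snd (last ?xs)) ?\<beta>). y < x} =
          card {q\<in>cuts ?\<beta>. snd (last ?xs) < q}"
        by (rule card_opens_above[OF nc\<beta>])
      then show ?thesis
        unfolding glued_opens_def chain_comp_def using False dis
        by (subst if_not_P, simp, subst card_Un_disjoint) auto
    qed
  qed
  finally show ?thesis by simp
qed

text \<open>Reading off the insertions is a bijection from glued words to chains, by
  \<open>olds_inj\<close> and \<open>olds_surj\<close>.\<close>

lemma cnt_glue: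
  assumes "nc 0 \<alpha>" "nc 0 \<beta>"
  shows "cnt (glue \<alpha> \<beta>) n m = card {xs\<in>stair_chains (opens \<alpha>) (cuts \<beta>).
    (length \<alpha> + length \<beta>) + length xs = n \<and> chain_comp (opens \<alpha>) (cuts \<beta>) xs = m}"
    (is "_ = card ?C")
proof -
  let ?M = "mx 0 \<alpha>" and ?\<beta> = "map (\<lambda>x. x + mx 0 \<alpha>) \<beta>"
  let ?F = "\<lambda>w. olds ?M 0 (drop (length \<alpha>) w)"
  let ?G = "{w\<in>glue \<alpha> \<beta>. length w = n \<and> ncomp w = m}"
  note glue = glue_iff[OF assms]
  have len: "length (\<alpha> @ r) = (length \<alpha> + length \<beta>) + length (olds ?M 0 r)"
    if "\<alpha> @ r \<in> glue \<alpha> \<beta>" for r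
    using that length_olds[of ?M r 0] unfolding glue by auto
  have "inj_on ?F ?G"
  proof (rule inj_onI)
    fix w w' assume "w \<in> ?G" "w' \<in> ?G" and eq: "?F w = ?F w'"
    then obtain r r' where "w = \<alpha> @ r" "w' = \<alpha> @ r'"
      "filter (\<lambda>x. ?M < x) r = ?\<beta>" "filter (\<lambda>x. ?M < x) r' = ?\<beta>"
      unfolding glue by blast
    then show "w = w'" using eq olds_inj[of ?M r r' 0] by simp
  qed
  moreover have "?F ` ?G = ?C"
  proof (intro equalityI subsetI)
    fix xs assume "xs \<in> ?F ` ?G"
    then obtain w where w: "w \<in> ?G" "xs = ?F w" by blast
    then obtain r where r: "w = \<alpha> @ r" "olds ?M 0 r \<in> stair_chains (opens \<alpha>) (cuts \<beta>)"
      unfolding glue by blast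
    then show "xs \<in> ?C" using w len[of r] ncomp_glue[OF assms, of r] by auto
  next
    fix xs assume xs: "xs \<in> ?C"
    have "\<exists>r. filter (\<lambda>x. ?M < x) r = ?\<beta> \<and> olds ?M 0 r = xs"
    proof (rule olds_surj)
      show "\<forall>x\<in>set ?\<beta>. ?M < x"
        using set_nc[OF assms(2)] by auto
      show "\<forall>z\<in>set xs. fst z \<le> ?M \<and> snd z \<le> 0 + length ?\<beta> \<and> 0 \<le> snd z"
      proof
        fix z assume "z \<in> set xs"
        then have "fst z \<in> opens \<alpha>" "snd z \<in> cuts \<beta>" using xs by (auto simp: stair_chains_def)
        then show "fst z \<le> ?M \<and> snd z \<le> 0 + length ?\<beta> \<and> 0 \<le> snd z"
          using opens_subset[of \<alpha>] mx_ge(1)[of "fst z" \<alpha> 0] by (auto simp: cuts_def)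
      qed
      have "sorted_wrt (\<lambda>z z'. fst z' \<le> fst z \<and> snd z \<le> snd z') xs"
        using xs by (simp add: stair_chains_def)
      then show "sorted_wrt (\<lambda>z z'. snd z \<le> snd z') xs" by (rule sorted_wrt_mono_rel[rotated]) simp
    qed
    then obtain r where r: "filter (\<lambda>x. ?M < x) r = ?\<beta>" "olds ?M 0 r = xs" by blast
    then have "\<alpha> @ r \<in> glue \<alpha> \<beta>" using xs unfolding glue by blast
    then have "\<alpha> @ r \<in> ?G" using xs len[of r] ncomp_glue[OF assms, of r] r by simp
    moreover have "xs = ?F (\<alpha> @ r)" using r by simp
    ultimately show "xs \<in> ?F ` ?G" by blast
  qed
  ultimately have "bij_betw ?F ?G ?C" by (simp add: bij_betw_def)
  then show ?thesis unfolding cnt_def by (rule bij_betw_same_card)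
qed

text \<open>By \<open>cnt_glue\<close> only the total length and the sizes of
  \<open>opens \<alpha>\<close> and \<open>cuts \<beta>\<close> matter, and these sizes are numbers
  of components. Hence either part may also be replaced by a word with the same statistics.\<close>

lemma cnt_glue_swap:
  assumes "nc 0 \<alpha>" "nc 0 \<beta>" "nc 0 \<alpha>'" "nc 0 \<beta>'"
    and "length \<alpha> = length \<alpha>'" "ncomp \<alpha> = ncomp \<alpha>'" "length \<beta> = length \<beta>'" "ncomp \<beta> = ncomp \<beta>'"
  shows "cnt (glue \<alpha> \<beta>) n m = cnt (glue \<beta>' \<alpha>') n m"
proof -
  have "card (opens \<alpha>) = card (cuts \<alpha>')" "card (cuts \<beta>) = card (opens \<beta>')"
    using assms by (simp_all add: ncomp_nc card_opens)
  then show ?thesis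
    using assms card_chains_swap[of "opens \<alpha>" "cuts \<beta>" "opens \<beta>'" "cuts \<alpha>'"]
    by (simp add: cnt_glue add.commute[of "length \<beta>'"])
qed

lemma glue_takeWhile:
  assumes "nc 0 w" "k \<le> mx 0 w"
  defines "\<alpha> \<equiv> takeWhile (\<lambda>x. x \<le> k) w"
  shows "nc 0 \<alpha>" "mx 0 \<alpha> = k" "\<exists>\<beta>. nc 0 \<beta> \<and> w \<in> glue \<alpha> \<beta>"
proof -
  obtain r where w: "w = \<alpha> @ r" and hd: "r = [] \<or> k < hd r"
  proof
    show "w = \<alpha> @ dropWhile (\<lambda>x. x \<le> k) w" by (simp add: \<alpha>_def)
    show "dropWhile (\<lambda>x. x \<le> k) w = [] \<or> k < hd (dropWhile (\<lambda>x. x \<le> k) w)"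
      using hd_dropWhile[of "\<lambda>x. x \<le> k" w] not_le by blast
  qed
  have \<alpha>_le: "x \<le> k" if "x \<in> set \<alpha>" for x using that set_takeWhileD unfolding \<alpha>_def by fastforce
  show \<alpha>: "nc 0 \<alpha>" using assms(1) nc_appendD unfolding w by blast
  have "mx 0 \<alpha> \<le> k" using \<alpha>_le by (simp add: mx_def)
  \<comment> \<open>If a letter follows the prefix, the first such letter exceeds \<open>k\<close>
    but is at most \<open>Suc (mx 0 \<alpha>)\<close> by restricted growth.\<close>
  moreover have "k \<le> mx 0 \<alpha>"
  proof (cases r)
    case Nil
    then show ?thesis using assms(2) unfolding w by simp
  next
    case (Cons y v)
    then have "rgf ((\<alpha> @ [y]) @ v)" using nc_imp_rgf[OF assms(1)] unfolding w by simp
    then have "rgf (\<alpha> @ [y])" by (rule rgf_appendD)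
    then show ?thesis using hd Cons by (simp add: rgf_snoc)
  qed
  ultimately show k: "mx 0 \<alpha> = k" by simp
  define \<beta> where "\<beta> = map (\<lambda>x. x - k) (filter (\<lambda>x. k < x) w)"
  have "map (\<lambda>x. x + k) \<beta> = map id (filter (\<lambda>x. k < x) w)"
    unfolding \<beta>_def map_map by (rule map_cong) auto
  then have \<beta>: "filter (\<lambda>x. k < x) w = map (\<lambda>x. x + k) \<beta>" by simp
  have "filter (\<lambda>x. k < x) \<alpha> = []" using \<alpha>_le by (auto simp: filter_empty_conv not_less)
  then have "filter (\<lambda>x. k < x) w = filter (\<lambda>x. k < x) r" unfolding w by simp
  moreover have "nc k (filter (\<lambda>x. k < x) r)"
    using nc_glue[OF \<alpha>, of r] hd assms(1) unfolding w k by blast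
  ultimately have "nc 0 \<beta>" using \<beta> nc_map_add by metis
  moreover have "w \<in> glue \<alpha> \<beta>"
    unfolding glue_def k using assms(1) \<beta> \<alpha>_def by simp
  ultimately show "\<exists>\<beta>. nc 0 \<beta> \<and> w \<in> glue \<alpha> \<beta>" by blast
qed

section \<open>Minimal prefixes and minimal suffixes containing a pattern\<close>

text \<open>Containment is monotone in the cut, so testing the next smaller prefix expresses
  minimality among all cuts.\<close>

definition lmin :: "nat list \<Rightarrow> nat list set" where
  "lmin \<sigma> = {u. nc 0 u \<and> contains u \<sigma> \<and> \<not> contains (takeWhile (\<lambda>x. x < mx 0 u) u) \<sigma>}"

text \<open>Upper subwords are kept shifted down, so removing the letter \<open>1\<close> raises the
  cut by one.\<close>

definition rmin :: "nat list \<Rightarrow> nat list set" where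
  "rmin \<sigma> = {u. nc 0 u \<and> contains u \<sigma> \<and> \<not> contains (filter (\<lambda>x. 1 < x) u) \<sigma>}"

lemma takeWhile_takeWhile_less:
  "takeWhile (\<lambda>x. x < k) (takeWhile (\<lambda>x. x \<le> k) w) = takeWhile (\<lambda>x. x < (k::nat)) w"
  by (induction w) auto

lemma subseq_takeWhile_mono:
  "(\<And>x. P x \<Longrightarrow> Q x) \<Longrightarrow> subseq (takeWhile P w) (takeWhile Q w)"
  by (induction w) auto

lemma subseq_filter_mono:
  "(\<And>x. P x \<Longrightarrow> Q x) \<Longrightarrow> subseq (filter P w) (filter Q w)"
  by (induction w) auto

text \<open>Minimality excludes the cuts below \<open>mx 0 \<alpha>\<close> and monotonicity gives
  the others. The threshold, and with it \<open>\<alpha>\<close>, can thus be read off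
  \<open>w\<close>.\<close>

lemma lmin_contains_prefix:
  assumes "\<alpha> \<in> lmin \<sigma>" "w \<in> glue \<alpha> \<beta>"
  shows "contains (takeWhile (\<lambda>x. x \<le> k) w) \<sigma> \<longleftrightarrow> mx 0 \<alpha> \<le> k"
proof
  have tw: "takeWhile (\<lambda>x. x \<le> mx 0 \<alpha>) w = \<alpha>" using assms(2) by (simp add: glue_def)
  show "mx 0 \<alpha> \<le> k" if c: "contains (takeWhile (\<lambda>x. x \<le> k) w) \<sigma>"
  proof (rule ccontr)
    assume "\<not> mx 0 \<alpha> \<le> k"
    then have "contains (takeWhile (\<lambda>x. x < mx 0 \<alpha>) w) \<sigma>"
      using c by (elim contains_mono) (rule subseq_takeWhile_mono, simp)
    then show False
      using assms(1) takeWhile_takeWhile_less[of "mx 0 \<alpha>" w] by (simp add: lmin_def tw)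
  qed
  show "contains (takeWhile (\<lambda>x. x \<le> k) w) \<sigma>" if "mx 0 \<alpha> \<le> k"
  proof -
    have "contains (takeWhile (\<lambda>x. x \<le> mx 0 \<alpha>) w) \<sigma>" using assms(1) by (simp add: lmin_def tw)
    then show ?thesis using that by (elim contains_mono) (rule subseq_takeWhile_mono, simp)
  qed
qed

text \<open>Raising the cut past \<open>mx 0 \<alpha>\<close> removes at least the letter
  \<open>1\<close> of \<open>\<beta>\<close>.\<close>

lemma rmin_contains_suffix:
  assumes "\<beta> \<in> rmin \<sigma>" "w \<in> glue \<alpha> \<beta>"
  shows "contains (filter (\<lambda>x. k < x) w) \<sigma> \<longleftrightarrow> k \<le> mx 0 \<alpha>"
proof
  let ?M = "mx 0 \<alpha>"
  have fl: "filter (\<lambda>x. ?M < x) w = map (\<lambda>x. x + ?M) \<beta>" using assms(2) by (simp add: glue_def)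
  show "k \<le> ?M" if c: "contains (filter (\<lambda>x. k < x) w) \<sigma>"
  proof (rule ccontr)
    assume "\<not> k \<le> ?M"
    then have "contains (filter (\<lambda>x. Suc ?M < x) w) \<sigma>"
      using c by (elim contains_mono) (rule subseq_filter_mono, simp)
    also have "filter (\<lambda>x. Suc ?M < x) w = filter (\<lambda>x. Suc ?M < x) (filter (\<lambda>x. ?M < x) w)"
      by (auto intro: filter_cong)
    also have "\<dots> = map (\<lambda>x. x + ?M) (filter (\<lambda>x. 1 < x) \<beta>)"
      unfolding fl filter_map o_def by simp
    finally show False using assms(1) by (simp add: rmin_def)
  qed
  show "contains (filter (\<lambda>x. k < x) w) \<sigma>" if "k \<le> ?M"
  proof -
    have "contains (filter (\<lambda>x. ?M < x) w) \<sigma>" unfolding fl using assms(1) by (simp add: rmin_def)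
    then show ?thesis using that by (elim contains_mono) (rule subseq_filter_mono, simp)
  qed
qed

lemma lmin_contains:
  assumes "\<alpha> \<in> lmin \<sigma>" "w \<in> glue \<alpha> \<beta>"
  shows "contains w \<sigma>"
proof -
  have "contains (takeWhile (\<lambda>x. x \<le> mx 0 \<alpha>) w) \<sigma>"
    using lmin_contains_prefix[OF assms] by blast
  then show ?thesis by (rule contains_mono) (simp add: prefix_imp_subseq takeWhile_is_prefix)
qed

lemma rmin_contains:
  assumes "\<beta> \<in> rmin \<sigma>" "w \<in> glue \<alpha> \<beta>"
  shows "contains w \<sigma>"
proof -
  have "contains (filter (\<lambda>x. 0 < x) w) \<sigma>" using rmin_contains_suffix[OF assms] by blast
  then show ?thesis by (rule contains_mono) simp
qed

lemma lmin_exists: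
  assumes "nc 0 w" "contains w \<sigma>" "\<sigma> \<noteq> []"
  shows "\<exists>\<alpha>\<in>lmin \<sigma>. \<exists>\<beta>. nc 0 \<beta> \<and> w \<in> glue \<alpha> \<beta>"
proof -
  let ?P = "\<lambda>k. contains (takeWhile (\<lambda>x. x \<le> k) w) \<sigma>"
  define k where "k = (LEAST k. ?P k)"
  have "takeWhile (\<lambda>x. x \<le> mx 0 w) w = w" using mx_ge(1) by (simp add: takeWhile_eq_all_conv)
  then have P: "?P (mx 0 w)" using assms(2) by (simp only:)
  then have Pk: "?P k" and le: "k \<le> mx 0 w" unfolding k_def by (rule LeastI, rule Least_le)
  have below: "\<not> ?P j" if "j < k" for j using that not_less_Least unfolding k_def by blast
  let ?\<alpha> = "takeWhile (\<lambda>x. x \<le> k) w"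
  note g = glue_takeWhile[OF assms(1) le]
  \<comment> \<open>Positivity makes \<open>x < k\<close> the cut at \<open>k - 1\<close>, to which
    minimality applies.\<close>
  have "k \<noteq> 0"
  proof
    assume "k = 0"
    then have "mx 0 ?\<alpha> = 0" using g(2) by simp
    then have "?\<alpha> = []" using set_nc[OF g(1)] by simp
    then show False using Pk assms(3) by simp
  qed
  then have "(\<lambda>x. x < k) = (\<lambda>x. x \<le> k - 1)" by (auto simp: fun_eq_iff)
  then have "\<not> contains (takeWhile (\<lambda>x. x < k) w) \<sigma>" using below[of "k - 1"] \<open>k \<noteq> 0\<close> by simp
  then have "?\<alpha> \<in> lmin \<sigma>"
    unfolding lmin_def using g(1,2) Pk takeWhile_takeWhile_less[of k w] by simp
  then show ?thesis using g(3) by blast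
qed

text \<open>A greatest suitable cut exists: beyond \<open>mx 0 w\<close> the upper subword is empty
  and cannot contain the nonempty \<open>\<sigma>\<close>.\<close>

lemma rmin_exists:
  assumes "nc 0 w" "contains w \<sigma>" "\<sigma> \<noteq> []"
  shows "\<exists>\<alpha>. nc 0 \<alpha> \<and> (\<exists>\<beta>\<in>rmin \<sigma>. w \<in> glue \<alpha> \<beta>)"
proof -
  let ?P = "\<lambda>k. contains (filter (\<lambda>x. k < x) w) \<sigma>"
  define k where "k = (GREATEST k. ?P k)"
  have "filter (\<lambda>x. 0 < x) w = w" using set_nc[OF assms(1)] by simp
  then have P0: "?P 0" using assms(2) by simp
  have bound: "j \<le> mx 0 w" if "?P j" for j
  proof (rule ccontr)
    assume "\<not> j \<le> mx 0 w"
    then have "filter (\<lambda>x. j < x) w = []"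
      using mx_ge(1)[of _ w 0] by (fastforce simp: filter_empty_conv)
    then show False using that assms(3) by simp
  qed
  have Pk: "?P k" unfolding k_def using P0 bound by (rule GreatestI_nat)
  have above: "\<not> ?P (Suc k)"
  proof
    assume "?P (Suc k)"
    then have "Suc k \<le> (GREATEST k. ?P k)" using bound by (rule Greatest_le_nat)
    then show False by (simp add: k_def)
  qed
  note g = glue_takeWhile[OF assms(1) bound[OF Pk]]
  obtain \<beta> where \<beta>: "nc 0 \<beta>" "w \<in> glue (takeWhile (\<lambda>x. x \<le> k) w) \<beta>" using g(3) by blast
  have fl: "filter (\<lambda>x. k < x) w = map (\<lambda>x. x + k) \<beta>" using \<beta>(2) g(2) by (simp add: glue_def)
  have "filter (\<lambda>x. Suc k < x) w = filter (\<lambda>x. Suc k < x) (filter (\<lambda>x. k < x) w)"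
    by (auto intro: filter_cong)
  also have "\<dots> = map (\<lambda>x. x + k) (filter (\<lambda>x. 1 < x) \<beta>)"
    unfolding fl filter_map o_def by simp
  finally have "\<beta> \<in> rmin \<sigma>" using above Pk fl \<beta>(1) by (simp add: rmin_def)
  then show ?thesis using g(1) \<beta>(2) by blast
qed

text \<open>The cuts admissible for \<open>\<sigma>\<close> are those from
  \<open>mx 0 \<alpha>\<close> on, and the smallest of them leaves the largest upper subword for
  \<open>\<rho>\<close>.\<close>

lemma lmin_contains_pcat:
  assumes "\<alpha> \<in> lmin \<sigma>" "w \<in> glue \<alpha> \<beta>" "rgf \<sigma>" "rgf \<rho>"
  shows "contains w (pcat \<sigma> \<rho>) \<longleftrightarrow> contains \<beta> \<rho>"
proof -
  have w: "nc 0 w" and fl: "filter (\<lambda>x. mx 0 \<alpha> < x) w = map (\<lambda>x. x + mx 0 \<alpha>) \<beta>"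
    using assms(2) by (auto simp: glue_def)
  have "contains (filter (\<lambda>x. mx 0 \<alpha> < x) w) \<rho>"
    if "mx 0 \<alpha> \<le> k" "contains (filter (\<lambda>x. k < x) w) \<rho>" for k
    using that(2) by (rule contains_mono) (use that(1) in \<open>auto intro: subseq_filter_mono\<close>)
  then have "contains w (pcat \<sigma> \<rho>) \<longleftrightarrow> contains (filter (\<lambda>x. mx 0 \<alpha> < x) w) \<rho>"
    unfolding contains_pcat_iff[OF w assms(3,4)] lmin_contains_prefix[OF assms(1,2)] by blast
  then show ?thesis unfolding fl by simp
qed

lemma rmin_contains_pcat:
  assumes "\<beta> \<in> rmin \<sigma>" "w \<in> glue \<alpha> \<beta>" "rgf \<sigma>" "rgf \<rho>"
  shows "contains w (pcat \<rho> \<sigma>) \<longleftrightarrow> contains \<alpha> \<rho>"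
proof -
  have w: "nc 0 w" and tw: "takeWhile (\<lambda>x. x \<le> mx 0 \<alpha>) w = \<alpha>"
    using assms(2) by (auto simp: glue_def)
  have "contains (takeWhile (\<lambda>x. x \<le> mx 0 \<alpha>) w) \<rho>"
    if "k \<le> mx 0 \<alpha>" "contains (takeWhile (\<lambda>x. x \<le> k) w) \<rho>" for k
    using that(2) by (rule contains_mono) (use that(1) in \<open>auto intro: subseq_takeWhile_mono\<close>)
  then have "contains w (pcat \<rho> \<sigma>) \<longleftrightarrow> contains (takeWhile (\<lambda>x. x \<le> mx 0 \<alpha>) w) \<rho>"
    unfolding contains_pcat_iff[OF w assms(4,3)] rmin_contains_suffix[OF assms(1,2)] by blast
  then show ?thesis unfolding tw .
qed

lemma lmin_unique:
  assumes "\<alpha> \<in> lmin \<sigma>" "w \<in> glue \<alpha> \<beta>" "\<alpha>' \<in> lmin \<sigma>" "w \<in> glue \<alpha>' \<beta>'"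
  shows "\<alpha> = \<alpha>'"
proof -
  have "mx 0 \<alpha> \<le> k \<longleftrightarrow> mx 0 \<alpha>' \<le> k" for k
    using lmin_contains_prefix[OF assms(1,2)] lmin_contains_prefix[OF assms(3,4)] by blast
  then have "mx 0 \<alpha> = mx 0 \<alpha>'" by (meson antisym order_refl)
  then show ?thesis using assms(2,4) by (simp add: glue_def)
qed

lemma rmin_unique:
  assumes "\<beta> \<in> rmin \<sigma>" "w \<in> glue \<alpha> \<beta>" "\<beta>' \<in> rmin \<sigma>" "w \<in> glue \<alpha>' \<beta>'"
  shows "\<alpha> = \<alpha>'"
proof -
  have "k \<le> mx 0 \<alpha> \<longleftrightarrow> k \<le> mx 0 \<alpha>'" for k
    using rmin_contains_suffix[OF assms(1,2)] rmin_contains_suffix[OF assms(3,4)] by blast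
  then have "mx 0 \<alpha> = mx 0 \<alpha>'" by (meson antisym order_refl)
  then show ?thesis using assms(2,4) by (simp add: glue_def)
qed

section \<open>Counting\<close>

lemma finite_nc: "finite {w. nc 0 w \<and> length w \<le> n}"
proof (rule finite_subset)
  show "{w. nc 0 w \<and> length w \<le> n} \<subseteq> {w. set w \<subseteq> {..n} \<and> length w \<le> n}"
    using set_nc nc_mx_le by fastforce
qed (simp add: finite_lists_length_le)

text \<open>Words of given size and number of components form finite classes, so equal counts give
  bijections class by class, which are then combined.\<close>

lemma ex_bij_of_cnt:
  assumes nc: "A \<subseteq> Collect (nc 0)" "B \<subseteq> Collect (nc 0)" and cnt: "\<And>n m. cnt A n m = cnt B n m"
  shows "\<exists>h. bij_betw h A B \<and> (\<forall>w\<in>A. length (h w) = length w \<and> ncomp (h w) = ncomp w)"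
proof -
  let ?F = "\<lambda>A n m. {w\<in>A. length w = n \<and> ncomp w = m}"
  have fin: "finite (?F A n m)" "finite (?F B n m)" for n m
    using nc by (auto intro: finite_subset[OF _ finite_nc[of n]])
  have "\<forall>s. \<exists>h. bij_betw h (?F A (fst s) (snd s)) (?F B (fst s) (snd s))"
    using cnt by (intro allI finite_same_card_bij[OF fin]) (simp add: cnt_def)
  then have "\<exists>H. \<forall>s. bij_betw (H s) (?F A (fst s) (snd s)) (?F B (fst s) (snd s))" by (rule choice)
  then obtain H where H: "\<And>s. bij_betw (H s) (?F A (fst s) (snd s)) (?F B (fst s) (snd s))" by blast
  define h where "h w = H (length w, ncomp w) w" for w
  have h: "h w \<in> ?F B (length w) (ncomp w)" if "w \<in> A" for w
    using bij_betwE[OF H[of "(length w, ncomp w)"]] that by (simp add: h_def)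
  have "inj_on h A"
  proof (rule inj_onI)
    fix v w assume vw: "v \<in> A" "w \<in> A" "h v = h w"
    then have eq: "length v = length w" "ncomp v = ncomp w" using h[of v] h[of w] by auto
    have "inj_on (H (length w, ncomp w)) (?F A (length w) (ncomp w))"
      using bij_betw_imp_inj_on[OF H[of "(length w, ncomp w)"]] by simp
    then show "v = w" using vw eq by (auto simp: h_def dest!: inj_onD)
  qed
  moreover have "h ` A = B"
  proof (intro equalityI subsetI)
    fix w assume "w \<in> B"
    then have "w \<in> H (length w, ncomp w) ` ?F A (length w) (ncomp w)"
      using bij_betw_imp_surj_on[OF H[of "(length w, ncomp w)"]] by simp
    then show "w \<in> h ` A" by (force simp: h_def)
  qed (use h in auto)
  ultimately show ?thesis using h by (auto simp: bij_betw_def)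
qed

lemma sum_eq_of_cnt:
  fixes g h :: "nat list \<Rightarrow> nat"
  assumes "A \<subseteq> Collect (nc 0)" "B \<subseteq> Collect (nc 0)" "\<And>n m. cnt A n m = cnt B n m"
    and gh: "\<And>a b. a \<in> A \<Longrightarrow> b \<in> B \<Longrightarrow> length a = length b \<Longrightarrow> ncomp a = ncomp b \<Longrightarrow> g a = h b"
  shows "sum g A = sum h B"
proof -
  obtain f where f: "bij_betw f A B" "\<forall>w\<in>A. length (f w) = length w \<and> ncomp (f w) = ncomp w"
    using ex_bij_of_cnt[OF assms(1-3)] by blast
  have "sum g A = (\<Sum>a\<in>A. h (f a))"
    using f bij_betwE[OF f(1)] by (intro sum.cong gh) auto
  then show ?thesis using sum.reindex_bij_betw[OF f(1)] by simp
qed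

lemma cnt_restrict: "cnt {a\<in>A. length a \<le> N} n m = (if n \<le> N then cnt A n m else 0)"
  "cnt {a\<in>A. length a < N} n m = (if n < N then cnt A n m else 0)"
  unfolding cnt_def by (auto intro!: arg_cong[of _ _ card] simp: card_eq_0_iff)

text \<open>Neither part is longer than the glued word, so lengths up to \<open>n\<close> suffice
  and the sums are finite. Uniqueness fixes \<open>\<alpha>\<close>, and then \<open>w\<close>
  determines \<open>\<beta>\<close>.\<close>

lemma cnt_Union_glue:
  assumes A: "A \<subseteq> Collect (nc 0)" and B: "B \<subseteq> Collect (nc 0)"
    and uniq: "\<And>w \<alpha> \<alpha>' \<beta> \<beta>'. \<alpha> \<in> A \<Longrightarrow> \<beta> \<in> B \<Longrightarrow> \<alpha>' \<in> A \<Longrightarrow> \<beta>' \<in> B \<Longrightarrow>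
      w \<in> glue \<alpha> \<beta> \<Longrightarrow> w \<in> glue \<alpha>' \<beta>' \<Longrightarrow> \<alpha> = \<alpha>'"
  shows "cnt {w. \<exists>\<alpha>\<in>A. \<exists>\<beta>\<in>B. w \<in> glue \<alpha> \<beta>} n m =
    (\<Sum>\<alpha>\<in>{\<alpha>\<in>A. length \<alpha> \<le> n}. \<Sum>\<beta>\<in>{\<beta>\<in>B. length \<beta> \<le> n}. cnt (glue \<alpha> \<beta>) n m)"
proof -
  let ?I = "{\<alpha>\<in>A. length \<alpha> \<le> n} \<times> {\<beta>\<in>B. length \<beta> \<le> n}"
  let ?S = "\<lambda>p. {w\<in>glue (fst p) (snd p). length w = n \<and> ncomp w = m}"
  have len: "length \<alpha> \<le> length w" "length \<beta> \<le> length w"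
    if mem: "\<alpha> \<in> A" "\<beta> \<in> B" "w \<in> glue \<alpha> \<beta>" for \<alpha> \<beta> w
  proof -
    have "nc 0 \<alpha>" "nc 0 \<beta>" using mem A B by auto
    then obtain r where "w = \<alpha> @ r" "filter (\<lambda>x. mx 0 \<alpha> < x) r = map (\<lambda>x. x + mx 0 \<alpha>) \<beta>"
      using mem(3) glue_iff by blast
    then have "length \<alpha> + length \<beta> \<le> length w"
      using length_filter_le[of "\<lambda>x. mx 0 \<alpha> < x" r] by simp
    then show "length \<alpha> \<le> length w" "length \<beta> \<le> length w" by auto
  qed
  have fin: "finite {\<alpha>\<in>A. length \<alpha> \<le> n}" "finite {\<beta>\<in>B. length \<beta> \<le> n}"
    using A B by (auto intro: finite_subset[OF _ finite_nc[of n]])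
  have "{w \<in> {w. \<exists>\<alpha>\<in>A. \<exists>\<beta>\<in>B. w \<in> glue \<alpha> \<beta>}. length w = n \<and> ncomp w = m} = (\<Union>p\<in>?I. ?S p)"
    using len by fastforce
  then have "cnt {w. \<exists>\<alpha>\<in>A. \<exists>\<beta>\<in>B. w \<in> glue \<alpha> \<beta>} n m = card (\<Union>p\<in>?I. ?S p)"
    unfolding cnt_def by simp
  also have "\<dots> = (\<Sum>p\<in>?I. card (?S p))"
  proof (rule card_UN_disjoint)
    show "finite ?I" using fin by blast
    show "\<forall>p\<in>?I. finite (?S p)"
      by (auto simp: glue_def intro: finite_subset[OF _ finite_nc[of n]])
    show "\<forall>p\<in>?I. \<forall>q\<in>?I. p \<noteq> q \<longrightarrow> ?S p \<inter> ?S q = {}"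
    proof (intro ballI impI)
      fix p q assume pq: "p \<in> ?I" "q \<in> ?I" "p \<noteq> q"
      show "?S p \<inter> ?S q = {}"
      proof (rule ccontr)
        assume "?S p \<inter> ?S q \<noteq> {}"
        then obtain w where w: "w \<in> glue (fst p) (snd p)" "w \<in> glue (fst q) (snd q)" by blast
        then have 1: "fst p = fst q" using uniq[of "fst p" "snd p" "fst q" "snd q" w] pq by auto
        have "map (\<lambda>x. x + mx 0 (fst q)) (snd p) = map (\<lambda>x. x + mx 0 (fst q)) (snd q)"
          using w 1 by (simp add: glue_def)
        then have "snd p = snd q" by (rule map_injective) (simp add: inj_def)
        then show False using 1 pq(3) by (simp add: prod_eq_iff)
      qed
    qed
  qed
  finally show ?thesis by (simp add: sum.cartesian_product cnt_def case_prod_unfold)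
qed

lemma cnt_disjoint_Un:
  assumes "A \<subseteq> Collect (nc 0)" "B \<subseteq> Collect (nc 0)" "A \<inter> B = {}"
  shows "cnt (A \<union> B) n m = cnt A n m + cnt B n m"
proof -
  have "finite {w\<in>A. length w = n \<and> ncomp w = m}" "finite {w\<in>B. length w = n \<and> ncomp w = m}"
    using assms by (auto intro: finite_subset[OF _ finite_nc[of n]])
  then have "card ({w\<in>A. length w = n \<and> ncomp w = m} \<union> {w\<in>B. length w = n \<and> ncomp w = m}) =
      cnt A n m + cnt B n m"
    unfolding cnt_def using assms(3) by (intro card_Un_disjoint) auto
  moreover have "{w\<in>A. length w = n \<and> ncomp w = m} \<union> {w\<in>B. length w = n \<and> ncomp w = m} =
      {w\<in>A \<union> B. length w = n \<and> ncomp w = m}" by auto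
  ultimately show ?thesis by (simp add: cnt_def)
qed

lemma lmin_nc: "lmin \<sigma> \<subseteq> Collect (nc 0)" and rmin_nc: "rmin \<sigma> \<subseteq> Collect (nc 0)"
  by (auto simp: lmin_def rmin_def)

lemma glue_Nil: "nc 0 \<alpha> \<Longrightarrow> glue \<alpha> [] = {\<alpha>}"
  unfolding set_eq_iff
proof (intro allI)
  fix w assume \<alpha>: "nc 0 \<alpha>"
  have "r = []" if "filter (\<lambda>x. mx 0 \<alpha> < x) r = []" "olds (mx 0 \<alpha>) 0 r \<in> stair_chains (opens \<alpha>) {}" for r
    using that length_olds[of "mx 0 \<alpha>" r 0] by (auto simp: stair_chains_def)
  moreover have "cuts [] = {}" by (auto simp: cuts_def)
  ultimately show "w \<in> glue \<alpha> [] \<longleftrightarrow> w \<in> {\<alpha>}"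
    unfolding glue_iff[OF \<alpha> nc_Nil] by (auto simp: stair_chains_def)
qed

text \<open>Cutting the words that contain \<open>\<sigma>\<close> at the least or at the greatest
  cut gives, after a swap, sums of one weight \<open>g\<close> over \<open>lmin \<sigma>\<close> and
  over \<open>rmin \<sigma>\<close>. Parts of length \<open>n\<close> contribute exactly the two
  counts to be compared; shorter parts agree by induction.\<close>

lemma cnt_lmin_eq_cnt_rmin:
  assumes "\<sigma> \<noteq> []"
  shows "cnt (lmin \<sigma>) n m = cnt (rmin \<sigma>) n m"
proof (induction n arbitrary: m rule: less_induct)
  case (less n)
  let ?D = "Collect (nc 0)" and ?Dn = "{\<beta>\<in>Collect (nc 0). length \<beta> \<le> n}"
  define g where "g \<alpha> = (\<Sum>\<beta>\<in>?Dn. cnt (glue \<alpha> \<beta>) n m)" for \<alpha>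
  \<comment> \<open>A part of full length \<open>n\<close> leaves room only for
    \<open>\<beta> = []\<close>.\<close>
  have g_full: "(\<Sum>\<alpha>\<in>{\<alpha>\<in>A. length \<alpha> = n}. g \<alpha>) = cnt A n m" if A: "A \<subseteq> ?D" for A
  proof -
    have "g \<alpha> = (if ncomp \<alpha> = m then 1 else 0)" if \<alpha>: "\<alpha> \<in> A" "length \<alpha> = n" for \<alpha>
    proof -
      have nc: "nc 0 \<alpha>" using A \<alpha> by auto
      have "cnt (glue \<alpha> \<beta>) n m = 0" if "\<beta> \<in> ?Dn - {[]}" for \<beta>
        using that \<alpha>(2) nc by (simp add: cnt_glue)
      then have "g \<alpha> = (\<Sum>\<beta>\<in>{[]}. cnt (glue \<alpha> \<beta>) n m)"
        unfolding g_def using finite_nc[of n] by (intro sum.mono_neutral_right) auto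
      also have "\<dots> = card {w. w = \<alpha> \<and> ncomp w = m}"
        using \<alpha>(2) by (simp add: glue_Nil[OF nc] cnt_def) (metis (mono_tags, lifting))
      also have "\<dots> = (if ncomp \<alpha> = m then 1 else 0)"
        by (cases "ncomp \<alpha> = m") (auto simp: conj_commute cong: conj_cong)
      finally show ?thesis .
    qed
    then have "(\<Sum>\<alpha>\<in>{\<alpha>\<in>A. length \<alpha> = n}. g \<alpha>) =
        (\<Sum>\<alpha>\<in>{\<alpha>\<in>A. length \<alpha> = n}. if ncomp \<alpha> = m then 1 else 0)" by simp
    moreover have "finite {\<alpha>\<in>A. length \<alpha> = n}"
      using A by (auto intro: finite_subset[OF _ finite_nc[of n]])
    ultimately show ?thesis by (simp add: sum.If_cases cnt_def Int_def conj_ac)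
  qed
  have g_split: "(\<Sum>\<alpha>\<in>{\<alpha>\<in>A. length \<alpha> \<le> n}. g \<alpha>) =
      (\<Sum>\<alpha>\<in>{\<alpha>\<in>A. length \<alpha> < n}. g \<alpha>) + cnt A n m" if A: "A \<subseteq> ?D" for A
  proof -
    have "{\<alpha>\<in>A. length \<alpha> \<le> n} = {\<alpha>\<in>A. length \<alpha> < n} \<union> {\<alpha>\<in>A. length \<alpha> = n}" by auto
    moreover have "finite {\<alpha>\<in>A. length \<alpha> < n}" "finite {\<alpha>\<in>A. length \<alpha> = n}"
      using A by (auto intro: finite_subset[OF _ finite_nc[of n]])
    ultimately show ?thesis
      unfolding g_full[OF A, symmetric] by (simp only:) (rule sum.union_disjoint, auto)
  qed
  have "(\<Sum>\<alpha>\<in>{\<alpha>\<in>lmin \<sigma>. length \<alpha> \<le> n}. g \<alpha>) =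
      cnt {w. \<exists>\<alpha>\<in>lmin \<sigma>. \<exists>\<beta>\<in>?D. w \<in> glue \<alpha> \<beta>} n m"
    unfolding g_def by (rule cnt_Union_glue[symmetric]) (use lmin_nc lmin_unique in blast)+
  also have "{w. \<exists>\<alpha>\<in>lmin \<sigma>. \<exists>\<beta>\<in>?D. w \<in> glue \<alpha> \<beta>} = {w. nc 0 w \<and> contains w \<sigma>}"
  proof (intro set_eqI iffI)
    fix w assume "w \<in> {w. \<exists>\<alpha>\<in>lmin \<sigma>. \<exists>\<beta>\<in>?D. w \<in> glue \<alpha> \<beta>}"
    then obtain \<alpha> \<beta> where \<alpha>: "\<alpha> \<in> lmin \<sigma>" "w \<in> glue \<alpha> \<beta>" by blast
    then have "contains w \<sigma>" by (rule lmin_contains)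
    then show "w \<in> {w. nc 0 w \<and> contains w \<sigma>}" using \<alpha>(2) by (simp add: glue_def)
  qed (use lmin_exists[OF _ _ assms] in blast)
  also have "{w. nc 0 w \<and> contains w \<sigma>} = {w. \<exists>\<alpha>\<in>?D. \<exists>\<beta>\<in>rmin \<sigma>. w \<in> glue \<alpha> \<beta>}"
  proof (intro set_eqI iffI)
    fix w assume "w \<in> {w. \<exists>\<alpha>\<in>?D. \<exists>\<beta>\<in>rmin \<sigma>. w \<in> glue \<alpha> \<beta>}"
    then obtain \<alpha> \<beta> where \<beta>: "\<beta> \<in> rmin \<sigma>" "w \<in> glue \<alpha> \<beta>" by blast
    then have "contains w \<sigma>" by (rule rmin_contains)
    then show "w \<in> {w. nc 0 w \<and> contains w \<sigma>}" using \<beta>(2) by (simp add: glue_def)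
  qed (use rmin_exists[OF _ _ assms] in blast)
  also have "cnt {w. \<exists>\<alpha>\<in>?D. \<exists>\<beta>\<in>rmin \<sigma>. w \<in> glue \<alpha> \<beta>} n m =
      (\<Sum>\<alpha>\<in>?Dn. \<Sum>\<beta>\<in>{\<beta>\<in>rmin \<sigma>. length \<beta> \<le> n}. cnt (glue \<alpha> \<beta>) n m)"
    by (rule cnt_Union_glue) (use rmin_nc rmin_unique in blast)+
  also have "\<dots> = (\<Sum>\<beta>\<in>{\<beta>\<in>rmin \<sigma>. length \<beta> \<le> n}. \<Sum>\<alpha>\<in>?Dn. cnt (glue \<alpha> \<beta>) n m)"
    by (rule sum.swap)
  \<comment> \<open>The swap moves the minimal part to the front, so that the same \<open>g\<close>
    appears on both sides.\<close>
  also have "\<dots> = (\<Sum>\<beta>\<in>{\<beta>\<in>rmin \<sigma>. length \<beta> \<le> n}. g \<beta>)"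
    unfolding g_def by (intro sum.cong refl cnt_glue_swap) (auto simp: rmin_def)
  finally have eq: "(\<Sum>\<alpha>\<in>{\<alpha>\<in>lmin \<sigma>. length \<alpha> < n}. g \<alpha>) + cnt (lmin \<sigma>) n m =
      (\<Sum>\<beta>\<in>{\<beta>\<in>rmin \<sigma>. length \<beta> < n}. g \<beta>) + cnt (rmin \<sigma>) n m"
    unfolding g_split[OF lmin_nc] g_split[OF rmin_nc] .
  have "(\<Sum>\<alpha>\<in>{\<alpha>\<in>lmin \<sigma>. length \<alpha> < n}. g \<alpha>) = (\<Sum>\<beta>\<in>{\<beta>\<in>rmin \<sigma>. length \<beta> < n}. g \<beta>)"
  proof (rule sum_eq_of_cnt)
    fix a b assume "a \<in> {\<alpha>\<in>lmin \<sigma>. length \<alpha> < n}" "b \<in> {\<beta>\<in>rmin \<sigma>. length \<beta> < n}"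
    then have nc: "nc 0 a" "nc 0 b" by (auto simp: lmin_def rmin_def)
    assume "length a = length b" "ncomp a = ncomp b"
    \<comment> \<open>Two swaps, passing through \<open>glue \<beta> b\<close>, replace
      \<open>a\<close> by \<open>b\<close>.\<close>
    then have "cnt (glue a \<beta>) n m = cnt (glue \<beta> b) n m" if "nc 0 \<beta>" for \<beta>
      using nc that by (intro cnt_glue_swap) auto
    moreover have "cnt (glue \<beta> b) n m = cnt (glue b \<beta>) n m" if "nc 0 \<beta>" for \<beta>
      using nc that by (intro cnt_glue_swap) auto
    ultimately show "g a = g b" unfolding g_def by (intro sum.cong refl) simp
  qed (use lmin_nc rmin_nc less in \<open>auto simp: cnt_restrict\<close>)
  then show ?case using eq by simp
qed

section \<open>Counting the avoiders of the two concatenations\<close>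

lemma Av_nc_eq: "Av_nc \<tau> = {w. nc 0 w \<and> \<not> contains w \<tau>}"
  by (simp add: Av_nc_def nc_iff avoids_def)

text \<open>Avoiders of a concatenation either avoid \<open>\<sigma>\<close> or are cut at their
  minimal part containing \<open>\<sigma>\<close>, and then the complementary part must avoid
  \<open>\<rho>\<close>.\<close>

lemma cnt_Av_nc_pcat:
  assumes "rgf \<sigma>" "rgf \<rho>" "\<sigma> \<noteq> []"
  shows "cnt (Av_nc (pcat \<sigma> \<rho>)) n m = cnt (Av_nc \<sigma>) n m +
      (\<Sum>\<alpha>\<in>{\<alpha>\<in>lmin \<sigma>. length \<alpha> \<le> n}. \<Sum>\<beta>\<in>{\<beta>\<in>Av_nc \<rho>. length \<beta> \<le> n}. cnt (glue \<alpha> \<beta>) n m)"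
    and "cnt (Av_nc (pcat \<rho> \<sigma>)) n m = cnt (Av_nc \<sigma>) n m +
      (\<Sum>\<alpha>\<in>{\<alpha>\<in>Av_nc \<rho>. length \<alpha> \<le> n}. \<Sum>\<beta>\<in>{\<beta>\<in>rmin \<sigma>. length \<beta> \<le> n}. cnt (glue \<alpha> \<beta>) n m)"
proof -
  let ?L = "{w. \<exists>\<alpha>\<in>lmin \<sigma>. \<exists>\<beta>\<in>Av_nc \<rho>. w \<in> glue \<alpha> \<beta>}"
  let ?R = "{w. \<exists>\<alpha>\<in>Av_nc \<rho>. \<exists>\<beta>\<in>rmin \<sigma>. w \<in> glue \<alpha> \<beta>}"
  have glue_nc: "nc 0 w" if "w \<in> glue \<alpha> \<beta>" for w \<alpha> \<beta> using that by (simp add: glue_def)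
  have mono: "contains w \<sigma>" if "nc 0 w" "contains w (pcat \<sigma> \<rho>) \<or> contains w (pcat \<rho> \<sigma>)" for w
  proof -
    have "\<exists>k. contains (takeWhile (\<lambda>x. x \<le> k) w) \<sigma> \<or> contains (filter (\<lambda>x. k < x) w) \<sigma>"
      using that(2) unfolding contains_pcat_iff[OF that(1) assms(1,2)]
        contains_pcat_iff[OF that(1) assms(2,1)] by blast
    then show ?thesis
      using contains_mono[OF _ subseq_filter_left]
        contains_mono[OF _ prefix_imp_subseq[OF takeWhile_is_prefix]] by blast
  qed
  have nc: "Av_nc \<tau> \<subseteq> Collect (nc 0)" for \<tau> by (auto simp: Av_nc_eq)
  have "Av_nc (pcat \<sigma> \<rho>) = Av_nc \<sigma> \<union> ?L"
  proof (intro equalityI subsetI)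
    fix w assume w: "w \<in> Av_nc (pcat \<sigma> \<rho>)"
    show "w \<in> Av_nc \<sigma> \<union> ?L"
    proof (cases "contains w \<sigma>")
      case True
      then obtain \<alpha> \<beta> where "\<alpha> \<in> lmin \<sigma>" "nc 0 \<beta>" "w \<in> glue \<alpha> \<beta>"
        using lmin_exists assms(3) w unfolding Av_nc_eq by blast
      moreover from this have "\<not> contains \<beta> \<rho>"
        using lmin_contains_pcat assms(1,2) w unfolding Av_nc_eq by blast
      ultimately show ?thesis unfolding Av_nc_eq by blast
    qed (use w in \<open>simp add: Av_nc_eq\<close>)
  next
    fix w assume "w \<in> Av_nc \<sigma> \<union> ?L"
    then show "w \<in> Av_nc (pcat \<sigma> \<rho>)"
      using lmin_contains_pcat[OF _ _ assms(1,2)] mono glue_nc unfolding Av_nc_eq by blast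
  qed
  moreover have "Av_nc \<sigma> \<inter> ?L = {}" using lmin_contains unfolding Av_nc_eq by blast
  moreover have "?L \<subseteq> Collect (nc 0)" using glue_nc by blast
  ultimately have "cnt (Av_nc (pcat \<sigma> \<rho>)) n m = cnt (Av_nc \<sigma>) n m + cnt ?L n m"
    using cnt_disjoint_Un nc by simp
  moreover have "cnt ?L n m = (\<Sum>\<alpha>\<in>{\<alpha>\<in>lmin \<sigma>. length \<alpha> \<le> n}.
      \<Sum>\<beta>\<in>{\<beta>\<in>Av_nc \<rho>. length \<beta> \<le> n}. cnt (glue \<alpha> \<beta>) n m)"
    using lmin_nc nc by (rule cnt_Union_glue) (use lmin_unique in blast)
  ultimately show "cnt (Av_nc (pcat \<sigma> \<rho>)) n m = cnt (Av_nc \<sigma>) n m +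
      (\<Sum>\<alpha>\<in>{\<alpha>\<in>lmin \<sigma>. length \<alpha> \<le> n}. \<Sum>\<beta>\<in>{\<beta>\<in>Av_nc \<rho>. length \<beta> \<le> n}. cnt (glue \<alpha> \<beta>) n m)"
    by simp
  have "Av_nc (pcat \<rho> \<sigma>) = Av_nc \<sigma> \<union> ?R"
  proof (intro equalityI subsetI)
    fix w assume w: "w \<in> Av_nc (pcat \<rho> \<sigma>)"
    show "w \<in> Av_nc \<sigma> \<union> ?R"
    proof (cases "contains w \<sigma>")
      case True
      then obtain \<alpha> \<beta> where "nc 0 \<alpha>" "\<beta> \<in> rmin \<sigma>" "w \<in> glue \<alpha> \<beta>"
        using rmin_exists assms(3) w unfolding Av_nc_eq by blast
      moreover from this have "\<not> contains \<alpha> \<rho>"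
        using rmin_contains_pcat assms(1,2) w unfolding Av_nc_eq by blast
      ultimately show ?thesis unfolding Av_nc_eq by blast
    qed (use w in \<open>simp add: Av_nc_eq\<close>)
  next
    fix w assume "w \<in> Av_nc \<sigma> \<union> ?R"
    then show "w \<in> Av_nc (pcat \<rho> \<sigma>)"
      using rmin_contains_pcat[OF _ _ assms(1,2)] mono glue_nc unfolding Av_nc_eq by blast
  qed
  moreover have "Av_nc \<sigma> \<inter> ?R = {}" using rmin_contains unfolding Av_nc_eq by blast
  moreover have "?R \<subseteq> Collect (nc 0)" using glue_nc by blast
  ultimately have "cnt (Av_nc (pcat \<rho> \<sigma>)) n m = cnt (Av_nc \<sigma>) n m + cnt ?R n m"
    using cnt_disjoint_Un nc by simp
  moreover have "cnt ?R n m = (\<Sum>\<alpha>\<in>{\<alpha>\<in>Av_nc \<rho>. length \<alpha> \<le> n}.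
      \<Sum>\<beta>\<in>{\<beta>\<in>rmin \<sigma>. length \<beta> \<le> n}. cnt (glue \<alpha> \<beta>) n m)"
    using nc rmin_nc by (rule cnt_Union_glue) (use rmin_unique in blast)
  ultimately show "cnt (Av_nc (pcat \<rho> \<sigma>)) n m = cnt (Av_nc \<sigma>) n m +
      (\<Sum>\<alpha>\<in>{\<alpha>\<in>Av_nc \<rho>. length \<alpha> \<le> n}. \<Sum>\<beta>\<in>{\<beta>\<in>rmin \<sigma>. length \<beta> \<le> n}. cnt (glue \<alpha> \<beta>) n m)"
    by simp
qed

theorem theorem3p3:
  assumes "rgf \<sigma>" and "rgf \<rho>" and "noncrossing \<sigma>" and "noncrossing \<rho>"
    and "connected_part \<sigma>"
  shows "cc_equiv (pcat \<sigma> \<rho>) (pcat \<rho> \<sigma>)"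
proof -
  have "\<sigma> \<noteq> []" using assms(5) by (simp add: connected_part_def)
  have nc: "Av_nc \<tau> \<subseteq> Collect (nc 0)" for \<tau> by (auto simp: Av_nc_eq)
  have "cnt (Av_nc (pcat \<sigma> \<rho>)) n m = cnt (Av_nc (pcat \<rho> \<sigma>)) n m" for n m
  proof -
    let ?B = "{\<beta>\<in>Av_nc \<rho>. length \<beta> \<le> n}"
    \<comment> \<open>Matching \<open>lmin \<sigma>\<close> with \<open>rmin \<sigma>\<close> by
      size and components and swapping the factors turns one double sum into the other; the summand
      \<open>cnt (Av_nc \<sigma>) n m\<close> is common to both counts.\<close>
    have "(\<Sum>\<alpha>\<in>{\<alpha>\<in>lmin \<sigma>. length \<alpha> \<le> n}. \<Sum>\<beta>\<in>?B. cnt (glue \<alpha> \<beta>) n m) =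
        (\<Sum>\<alpha>\<in>{\<alpha>\<in>rmin \<sigma>. length \<alpha> \<le> n}. \<Sum>\<beta>\<in>?B. cnt (glue \<beta> \<alpha>) n m)"
    proof (rule sum_eq_of_cnt)
      fix a b assume "a \<in> {\<alpha>\<in>lmin \<sigma>. length \<alpha> \<le> n}" "b \<in> {\<alpha>\<in>rmin \<sigma>. length \<alpha> \<le> n}"
        and "length a = length b" "ncomp a = ncomp b"
      then show "(\<Sum>\<beta>\<in>?B. cnt (glue a \<beta>) n m) = (\<Sum>\<beta>\<in>?B. cnt (glue \<beta> b) n m)"
        by (intro sum.cong refl cnt_glue_swap) (auto simp: lmin_def rmin_def Av_nc_eq)
    qed (use lmin_nc rmin_nc cnt_lmin_eq_cnt_rmin[OF \<open>\<sigma> \<noteq> []\<close>] in \<open>auto simp: cnt_restrict\<close>)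
    also have "\<dots> = (\<Sum>\<beta>\<in>?B. \<Sum>\<alpha>\<in>{\<alpha>\<in>rmin \<sigma>. length \<alpha> \<le> n}. cnt (glue \<beta> \<alpha>) n m)"
      by (rule sum.swap)
    finally show ?thesis using cnt_Av_nc_pcat[OF assms(1,2) \<open>\<sigma> \<noteq> []\<close>] by simp
  qed
  then show ?thesis unfolding cc_equiv_def by (intro ex_bij_of_cnt nc)
qed

end
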